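(* Let $\mathcal{P}=\{P_{\theta,G}:\theta\in\Theta,\ G\in\mathcal{G}\}$, with $\Theta\subset\mathbb{R}^k$ open, be a regular semiparametric model. Let $N\subset\mathbb{R}^d$ be open, $d<k$, and let $f:N\to\mathbb{R}^k$ be a known continuously differentiable function with $f(N)\subset\Theta$ whose $k\times d$ Jacobian matrix $\dot f(\nu)=(\partial f_i(\nu)/\partial\nu_j)_{i=1,\dots,k;\,j=1,\dots,d}$ has full rank $d$ for every $\nu\in N$, and which has an inverse on $f(N)$ that is differentiable with a bounded Jacobian. Let $\nu_0\in N$, $\theta_0=f(\nu_0)$, $G_0\in\mathcal{G}$, $P_0=P_{\theta_0,G_0}$, and let $\mathcal{Q}=\{P_{f(\nu),G}:\nu\in N,\ G\in\mathcal{G}\}$. Suppose there exist a least favorable sequence of regular parametric submodels $\mathcal{P}_{\psi_j}$ of $\mathcal{P}$ at $P_0$, with limiting efficient score function $\dot\ell(\theta_0,G_0,\mathcal{P})$, and an asymptotically efficient estimator $\hat\theta_n$ of $\theta$ based on i.i.d. observations $X_1,\dots,X_n$, i.e. a regular estimator with $$\sqrt n\Big(\hat\theta_n-\theta_0-\frac1n\sum_{i=1}^n\tilde\ell(X_i;\theta_0,G_0,\mathcal{P})\Big)\to_{P_0}0,$$ where $I(\theta_0,G_0,\mathcal{P})=\int\dot\ell(\theta_0,G_0,\mathcal{P})\,\dot\ell^T(\theta_0,G_0,\mathcal{P})\,dP_0$ and $\tilde\ell(\cdot;\theta_0,G_0,\mathcal{P})=I^{-1}(\theta_0,G_0,\mathcal{P})\,\dot\ell(\cdot;\theta_0,G_0,\mathcal{P})$.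 If the symmetric positive definite $k\times k$-matrix $\hat I_n$ is a consistent estimator of $I(\theta,G,\mathcal{P})$ within $\mathcal{P}$ and $\bar\nu_n$ (with values in $N$) is a $\sqrt n$-consistent estimator of $\nu$ within $\mathcal{Q}$, then $$\hat\nu_n=\bar\nu_n+\big(\dot f^T(\bar\nu_n)\hat I_n\dot f(\bar\nu_n)\big)^{-1}\dot f^T(\bar\nu_n)\hat I_n\big[\hat\theta_n-f(\bar\nu_n)\big]$$ is efficient for $\nu$ within $\mathcal{Q}$ at $P_0$, i.e. $$\sqrt n\Big(\hat\nu_n-\nu_0-\frac1n\sum_{i=1}^n\tilde\ell(X_i;\nu_0,G_0,\mathcal{Q})\Big)\to_{P_0}0$$ with $$\tilde\ell(\nu_0,G_0,\mathcal{Q})=\big(\dot f^T(\nu_0)I(\theta_0,G_0,\mathcal{P})\dot f(\nu_0)\big)^{-1}\dot f^T(\nu_0)\,\dot\ell(\theta_0,G_0,\mathcal{P}).$$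
   Context: All distributions live on a measurable space $(\mathcal{X},\mathcal{A})$. $X_1,X_2,\dots$ are i.i.d.; $\to_{P_0}0$ denotes convergence to $0$ in probability when the observations have distribution $P_0$. $\mathcal{G}$ is an arbitrary (nuisance) parameter set, typically a subset of a Banach or Hilbert space. Regular parametric model: $\mathcal{P}_\Theta=\{P_\theta:\theta\in\Theta\}$, $\Theta\subset\mathbb{R}^k$ open, all $P_\theta$ dominated by a $\sigma$-finite measure $\mu$ with densities $p(\theta)$, such that (i) for each $\theta_0\in\Theta$ there is a $k$-vector $\dot\ell(\theta_0,\mathcal{P}_\Theta)$ of elements of $L_2(P_{\theta_0})$ (the score function) with $\|\sqrt{p(\theta)}-\sqrt{p(\theta_0)}-\frac12(\theta-\theta_0)^T\dot\ell(\theta_0,\mathcal{P}_\Theta)\sqrt{p(\theta_0)}\|_{L_2(\mu)}=o(|\theta-\theta_0|)$ as $\theta\to\theta_0$; (ii) the Fisher information matrix $\int\dot\ell(\theta_0,\mathcal{P}_\Theta)\dot\ell^T(\theta_0,\mathcal{P}_\Theta)dP_{\theta_0}$ is nonsingular; (iii) the map $\theta\mapsto\dot\ell(\theta,\mathcal{P}_\Theta)\sqrt{p(\theta)}$ from $\Theta$ to $L_2^k(\mu)$ is continuous. Regular semiparametric model: $\mathcal{P}=\{P_{\theta,G}\}$ such that for every $G\in\mathcal{G}$ the model $\{P_{\theta,G}:\theta\in\Theta\}$ is a regular parametric model. Regular parametric submodel of $\mathcal{P}$ through $P_0=P_{\theta_0,G_0}$: a regular parametric model $\mathcal{P}_\psi=\{P_{\theta,\psi(\theta)}:\theta\in\Theta\}$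 with $\psi:\Theta\to\mathcal{G}$, $\psi(\theta_0)=G_0$; its score at $\theta_0$ is denoted $\dot\ell(\theta_0,\mathcal{P}_\psi)$. Regular estimator: within a regular parametric model, $\hat\theta_n$ is (locally) regular at $\theta_0$ if for every sequence $\theta_n$ with $\sqrt n(\theta_n-\theta_0)$ bounded, the law of $\sqrt n(\hat\theta_n-\theta_n)$ under $\theta_n$ converges weakly to a limit not depending on the sequence. Within $\mathcal{P}$, $\hat\theta_n$ is regular at $P_0$ if it is regular at $P_0$ within every regular parametric submodel $\mathcal{P}_\psi$ through $P_0$. Least favorable sequence at $P_0$: a sequence of regular parametric submodels $\mathcal{P}_{\psi_j}$ through $P_0$ whose scores $\dot\ell(\theta_0,\mathcal{P}_{\psi_j})$ converge in $L_2^k(P_0)$ to a limit $\dot\ell(\theta_0,G_0,\mathcal{P})$ (the efficient score function), with nonsingular $I(\theta_0,G_0,\mathcal{P})$, and such that the corresponding bound is attained, i.e. there is an estimator that is asymptotically linear at $P_0$ with influence function $\tilde\ell(\cdot;\theta_0,G_0,\mathcal{P})$. $I(\theta,G,\mathcal{P})$ denotes the efficient information matrix at $P_{\theta,G}$, defined at every $P_{\theta,G}\in\mathcal{P}$ as it is at $P_0$ (the efficient score function is assumed to exist at every point of $\mathcal{P}$). "$\hat I_n$ consistent within $\mathcal{P}$" means $\hat I_n\to I(\theta,G,\mathcal{P})$ in $P_{\theta,G}$-probability for every $P_{\theta,G}\in\mathcal{P}$ (in particular at $P_0$). "$\bar\nu_n$ is $\sqrt n$-consistent within $\mathcal{Q}$"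 means $\sqrt n(\bar\nu_n-\nu)=O_p(1)$ under $P_{f(\nu),G}$ for every $\nu\in N$, $G\in\mathcal{G}$ (in particular at $P_0$). *)

theory Defs
  imports "HOL-Probability.Probability" "HOL-Library.Landau_Symbols"
begin

section \<open>Square-integrable functions and information matrices\<close>

definition square_integrable :: "'a measure \<Rightarrow> ('a \<Rightarrow> real^'k) \<Rightarrow> bool" where
  "square_integrable \<mu> g \<longleftrightarrow>
     g \<in> borel_measurable \<mu> \<and> integrable \<mu> (\<lambda>x. (norm (g x))\<^sup>2)"

text \<open>The norm of \<open>L\<^sub>2(\<mu>)\<close> for real-valued \<open>g\<close>, of \<open>L\<^sub>2\<^sup>k(\<mu>)\<close> for vector-valued \<open>g\<close>.
  The Bochner integral is 0 when \<open>g\<close> is not square-integrable, so this is the norm only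
  for square-integrable \<open>g\<close>; wherever it is used below, square-integrability of the argument
  follows from the other clauses.\<close>

definition L2norm :: "'a measure \<Rightarrow> ('a \<Rightarrow> 'b::real_normed_vector) \<Rightarrow> real" where
  "L2norm \<mu> g = sqrt (\<integral>x. (norm (g x))\<^sup>2 \<partial>\<mu>)"

definition information :: "'a measure \<Rightarrow> ('a \<Rightarrow> real^'k) \<Rightarrow> real^'k^'k" where
  "information P l = (\<chi> i j. \<integral>x. l x $ i * l x $ j \<partial>P)"

definition influence :: "'a measure \<Rightarrow> ('a \<Rightarrow> real^'k) \<Rightarrow> 'a \<Rightarrow> real^'k" where
  "influence P l x = matrix_inv (information P l) *v l x"

definition sym_pos_def :: "real^'k^'k \<Rightarrow> bool" where
  "sym_pos_def A \<longleftrightarrow> transpose A = A \<and> (\<forall>v. v \<noteq> 0 \<longrightarrow> 0 < v \<bullet> (A *v v))"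


section \<open>Regular parametric and semiparametric models\<close>

text \<open>Only the space and the \<open>\<sigma>\<close>-algebra of \<open>M\<close> matter. \<open>s \<theta>\<close> is the score function at \<open>\<theta>\<close>,
  and \<open>p \<theta>\<close> is the \<open>\<mu>\<close>-density of \<open>P \<theta>\<close>. The three last clauses are Hellinger
  differentiability, nonsingularity of the Fisher information, and \<open>L\<^sub>2\<close>-continuity of
  \<open>\<theta> \<mapsto> s \<theta> \<surd>p(\<theta>)\<close>.\<close>

definition regular_parametric_model_score ::
  "'a measure \<Rightarrow> (real^'k) set \<Rightarrow> (real^'k \<Rightarrow> 'a measure) \<Rightarrow> (real^'k \<Rightarrow> 'a \<Rightarrow> real^'k) \<Rightarrow> bool" where
  "regular_parametric_model_score M \<Theta> P s \<longleftrightarrow>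
     open \<Theta> \<and>
     (\<forall>\<theta>\<in>\<Theta>. prob_space (P \<theta>) \<and> sets (P \<theta>) = sets M \<and> square_integrable (P \<theta>) (s \<theta>)) \<and>
     (\<exists>\<mu> p. sigma_finite_measure \<mu> \<and> sets \<mu> = sets M \<and>
        (\<forall>\<theta>\<in>\<Theta>. p \<theta> \<in> borel_measurable \<mu> \<and> (\<forall>x. 0 \<le> p \<theta> x) \<and>
              P \<theta> = density \<mu> (\<lambda>x. ennreal (p \<theta> x))) \<and>
        (\<forall>\<theta>0\<in>\<Theta>.
           (\<lambda>\<theta>. L2norm \<mu> (\<lambda>x. sqrt (p \<theta> x) - sqrt (p \<theta>0 x)
                              - 1/2 * ((\<theta> - \<theta>0) \<bullet> s \<theta>0 x) * sqrt (p \<theta>0 x)))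
             \<in> o[at \<theta>0 within \<Theta>](\<lambda>\<theta>. norm (\<theta> - \<theta>0)) \<and>
           invertible (information (P \<theta>0) (s \<theta>0)) \<and>
           ((\<lambda>\<theta>. L2norm \<mu> (\<lambda>x. sqrt (p \<theta> x) *\<^sub>R s \<theta> x - sqrt (p \<theta>0 x) *\<^sub>R s \<theta>0 x))
              \<longlongrightarrow> 0) (at \<theta>0 within \<Theta>)))"

definition regular_parametric_model ::
  "'a measure \<Rightarrow> (real^'k) set \<Rightarrow> (real^'k \<Rightarrow> 'a measure) \<Rightarrow> bool" where
  "regular_parametric_model M \<Theta> P \<longleftrightarrow> (\<exists>s. regular_parametric_model_score M \<Theta> P s)"

definition regular_semiparametric_model ::
  "'a measure \<Rightarrow> (real^'k) set \<Rightarrow> 'g set \<Rightarrow> (real^'k \<Rightarrow> 'g \<Rightarrow> 'a measure) \<Rightarrow> bool" where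
  "regular_semiparametric_model M \<Theta> \<G> P \<longleftrightarrow>
     (\<forall>G\<in>\<G>. regular_parametric_model M \<Theta> (\<lambda>\<theta>. P \<theta> G))"

text \<open>The submodel \<open>{P \<theta> (\<psi> \<theta>) | \<theta> \<in> \<Theta>}\<close> through \<open>P \<theta>0 G0\<close>, with score functions \<open>s\<close>.\<close>

definition regular_submodel ::
  "'a measure \<Rightarrow> (real^'k) set \<Rightarrow> 'g set \<Rightarrow> (real^'k \<Rightarrow> 'g \<Rightarrow> 'a measure) \<Rightarrow> real^'k \<Rightarrow> 'g \<Rightarrow>
   (real^'k \<Rightarrow> 'g) \<Rightarrow> (real^'k \<Rightarrow> 'a \<Rightarrow> real^'k) \<Rightarrow> bool" where
  "regular_submodel M \<Theta> \<G> P \<theta>0 G0 \<psi> s \<longleftrightarrow>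
     \<theta>0 \<in> \<Theta> \<and> \<psi> ` \<Theta> \<subseteq> \<G> \<and> \<psi> \<theta>0 = G0 \<and>
     regular_parametric_model_score M \<Theta> (\<lambda>\<theta>. P \<theta> (\<psi> \<theta>)) s"


section \<open>Estimators\<close>

text \<open>The law of the i.i.d. observations \<open>X\<^sub>1, \<dots>, X\<^sub>n\<close>; coordinate \<open>i < n\<close> is \<open>X\<close> with index
  \<open>i + 1\<close>. An estimator is a sequence of measurable functions of the observations.\<close>

definition sample :: "'a measure \<Rightarrow> nat \<Rightarrow> (nat \<Rightarrow> 'a) measure" where
  "sample P n = PiM {..<n} (\<lambda>_. P)"

definition estimator ::
  "'a measure \<Rightarrow> (nat \<Rightarrow> (nat \<Rightarrow> 'a) \<Rightarrow> 'b::topological_space) \<Rightarrow> bool" where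
  "estimator M T \<longleftrightarrow> (\<forall>n. T n \<in> borel_measurable (sample M n))"

definition tendsto_in_prob ::
  "'a measure \<Rightarrow> (nat \<Rightarrow> (nat \<Rightarrow> 'a) \<Rightarrow> 'b::real_normed_vector) \<Rightarrow> 'b \<Rightarrow> bool" where
  "tendsto_in_prob P Y c \<longleftrightarrow>
     (\<forall>\<epsilon>>0. (\<lambda>n. measure (sample P n) {x \<in> space (sample P n). \<epsilon> < norm (Y n x - c)})
              \<longlonglongrightarrow> 0)"

definition bounded_in_prob ::
  "'a measure \<Rightarrow> (nat \<Rightarrow> (nat \<Rightarrow> 'a) \<Rightarrow> 'b::real_normed_vector) \<Rightarrow> bool" where
  "bounded_in_prob P Y \<longleftrightarrow>
     (\<forall>\<epsilon>>0. \<exists>K. \<forall>\<^sub>F n in sequentially.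
        measure (sample P n) {x \<in> space (sample P n). K < norm (Y n x)} < \<epsilon>)"

definition weakly_converges ::
  "(nat \<Rightarrow> 'b::topological_space measure) \<Rightarrow> 'b measure \<Rightarrow> bool" where
  "weakly_converges L L' \<longleftrightarrow>
     (\<forall>g :: 'b \<Rightarrow> real. continuous_on UNIV g \<and> bounded (range g) \<longrightarrow>
        (\<lambda>n. \<integral>y. g y \<partial>L n) \<longlonglongrightarrow> (\<integral>y. g y \<partial>L'))"

definition locally_regular ::
  "(real^'k) set \<Rightarrow> (real^'k \<Rightarrow> 'a measure) \<Rightarrow> real^'k \<Rightarrow>
   (nat \<Rightarrow> (nat \<Rightarrow> 'a) \<Rightarrow> real^'k) \<Rightarrow> bool" where
  "locally_regular \<Theta> P \<theta>0 T \<longleftrightarrow>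
     (\<exists>L. prob_space L \<and> sets L = sets borel \<and>
        (\<forall>t. (\<forall>n. t n \<in> \<Theta>) \<and> bounded (range (\<lambda>n. sqrt (real n) *\<^sub>R (t n - \<theta>0))) \<longrightarrow>
           weakly_converges
             (\<lambda>n. distr (sample (P (t n)) n) borel (\<lambda>x. sqrt (real n) *\<^sub>R (T n x - t n))) L))"

definition regular_estimator ::
  "'a measure \<Rightarrow> (real^'k) set \<Rightarrow> 'g set \<Rightarrow> (real^'k \<Rightarrow> 'g \<Rightarrow> 'a measure) \<Rightarrow> real^'k \<Rightarrow> 'g \<Rightarrow>
   (nat \<Rightarrow> (nat \<Rightarrow> 'a) \<Rightarrow> real^'k) \<Rightarrow> bool" where
  "regular_estimator M \<Theta> \<G> P \<theta>0 G0 T \<longleftrightarrow>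
     estimator M T \<and>
     (\<forall>\<psi> s. regular_submodel M \<Theta> \<G> P \<theta>0 G0 \<psi> s \<longrightarrow>
        locally_regular \<Theta> (\<lambda>\<theta>. P \<theta> (\<psi> \<theta>)) \<theta>0 T)"

definition asymptotically_linear ::
  "'a measure \<Rightarrow> (nat \<Rightarrow> (nat \<Rightarrow> 'a) \<Rightarrow> real^'k) \<Rightarrow> real^'k \<Rightarrow> ('a \<Rightarrow> real^'k) \<Rightarrow> bool" where
  "asymptotically_linear P T \<theta>0 h \<longleftrightarrow>
     tendsto_in_prob P
       (\<lambda>n x. sqrt (real n) *\<^sub>R (T n x - \<theta>0 - (1 / real n) *\<^sub>R (\<Sum>i<n. h (x i)))) 0"


section \<open>Efficient scores\<close>

definition least_favorable_sequence ::
  "'a measure \<Rightarrow> (real^'k) set \<Rightarrow> 'g set \<Rightarrow> (real^'k \<Rightarrow> 'g \<Rightarrow> 'a measure) \<Rightarrow> real^'k \<Rightarrow> 'g \<Rightarrow>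
   (nat \<Rightarrow> real^'k \<Rightarrow> 'g) \<Rightarrow> ('a \<Rightarrow> real^'k) \<Rightarrow> bool" where
  "least_favorable_sequence M \<Theta> \<G> P \<theta>0 G0 \<psi> l \<longleftrightarrow>
     square_integrable (P \<theta>0 G0) l \<and>
     (\<exists>s. (\<forall>j. regular_submodel M \<Theta> \<G> P \<theta>0 G0 (\<psi> j) (s j)) \<and>
          (\<lambda>j. L2norm (P \<theta>0 G0) (\<lambda>x. s j \<theta>0 x - l x)) \<longlonglongrightarrow> 0) \<and>
     invertible (information (P \<theta>0 G0) l) \<and>
     (\<exists>T. estimator M T \<and> asymptotically_linear (P \<theta>0 G0) T \<theta>0 (influence (P \<theta>0 G0) l))"

text \<open>Efficient scores are only determined almost everywhere, hence a predicate on
  representatives \<open>l\<close>.\<close>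

definition efficient_score ::
  "'a measure \<Rightarrow> (real^'k) set \<Rightarrow> 'g set \<Rightarrow> (real^'k \<Rightarrow> 'g \<Rightarrow> 'a measure) \<Rightarrow> real^'k \<Rightarrow> 'g \<Rightarrow>
   ('a \<Rightarrow> real^'k) \<Rightarrow> bool" where
  "efficient_score M \<Theta> \<G> P \<theta>0 G0 l \<longleftrightarrow>
     (\<exists>\<psi>. least_favorable_sequence M \<Theta> \<G> P \<theta>0 G0 \<psi> l)"

end

theory Submission
  imports Defs
begin

text \<open>The estimator \<open>\<nu>hat\<close> takes one weighted least squares step from \<open>\<nu>bar\<close>. Its coefficient
  matrix \<open>C\<close> is a left inverse of \<open>Df\<close> and converges in probability, so linearizing \<open>f\<close> at \<open>\<nu>0\<close>
  cancels \<open>\<nu>bar - \<nu>0\<close> up to terms that are \<open>o(1)\<close> times an \<open>O(1)\<close> sequence after scaling by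
  \<open>\<surd>n\<close>. Tightness of \<open>\<surd>n (\<theta>hat - \<theta>0)\<close> is read off from its weak convergence along the constant
  sequence \<open>\<theta>0\<close>, so neither the central limit theorem nor centred scores are needed.
  A least favorable sequence for the restricted model arises by composing the one for the full model
  with \<open>f\<close>: the chain rule multiplies each score by \<open>Df\<^sup>T\<close>, and the one-step estimator itself
  attains the resulting bound.\<close>

section \<open>Matrices and weighted least squares\<close>

text \<open>The norm on \<open>real^'n^'m\<close> is the Euclidean norm of the row norms, so
  Cauchy-Schwarz in each row gives the constant 1.\<close>

lemma norm_matrix_vector_mult_le:
  fixes A :: "real^'n^'m"
  shows "norm (A *v x) \<le> norm A * norm x"
proof -
  have "norm (A *v x) = L2_set (\<lambda>i. \<bar>A $ i \<bullet> x\<bar>) UNIV"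
    by (simp add: norm_vec_def matrix_vector_mul_component)
  also have "\<dots> \<le> L2_set (\<lambda>i. norm (A $ i) * norm x) UNIV"
    by (intro L2_set_mono) (auto simp: Cauchy_Schwarz_ineq2)
  also have "\<dots> = norm A * norm x"
    by (simp add: norm_vec_def L2_set_left_distrib)
  finally show ?thesis .
qed

lemma bounded_bilinear_matrix_vector_mult:
  "bounded_bilinear ((*v) :: real^'n^'m \<Rightarrow> real^'n \<Rightarrow> real^'m)"
  by unfold_locales
     (auto simp: algebra_simps scaleR_matrix_vector_assoc
      intro!: exI[of _ 1] order_trans[OF norm_matrix_vector_mult_le])

lemma bounded_bilinear_matrix_matrix_mult:
  "bounded_bilinear ((**) :: real^'n^'m \<Rightarrow> real^'p^'n \<Rightarrow> real^'p^'m)"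
  unfolding bilinear_conv_bounded_bilinear[symmetric] bilinear_def
  by (auto intro!: linearI
      simp: matrix_matrix_mult_def vec_eq_iff sum_distrib_left sum.distrib algebra_simps)

lemma bounded_linear_transpose: "bounded_linear (transpose :: real^'n^'m \<Rightarrow> real^'m^'n)"
  unfolding linear_conv_bounded_linear[symmetric]
  by (auto intro!: linearI simp: transpose_def vec_eq_iff)

section \<open>Continuity of the matrix inverse\<close>

lemma matrix_inv_mult:
  assumes "invertible A"
  shows matrix_inv_right: "A ** matrix_inv A = mat 1"
    and matrix_inv_left: "matrix_inv A ** A = mat 1"
  using someI_ex[OF assms[unfolded invertible_def]] by (auto simp: matrix_inv_def)

text \<open>Column \<open>j\<close> of the inverse solves \<open>A *v x = axis j 1\<close>, and
  Cramer's rule solves this system explicitly. Every entry becomes a quotient of polynomials in the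
  entries of \<open>A\<close>.\<close>

lemma matrix_inv_cramer:
  fixes A :: "real^'n^'n"
  assumes "invertible A"
  shows "matrix_inv A =
    (\<chi> i j. det (\<chi> a b. if b = i then axis j 1 $ a else A $ a $ b) / det A)"
proof -
  have "A *v column j (matrix_inv A) = axis j 1" for j
  proof -
    have "A *v column j (matrix_inv A) = A *v (matrix_inv A *v axis j 1)"
      by (simp only: matrix_vector_mult_basis)
    also have "\<dots> = axis j 1"
      by (simp only: matrix_vector_mul_assoc matrix_inv_right[OF assms] matrix_vector_mul_lid)
    finally show ?thesis .
  qed
  then have "column j (matrix_inv A) =
      (\<chi> i. det (\<chi> a b. if b = i then axis j 1 $ a else A $ a $ b) / det A)" for j
    using assms cramer[of A] by (simp add: invertible_det_nz)
  then show ?thesis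
    by (simp add: vec_eq_iff column_def)
qed

lemma continuous_on_matrix_inv:
  "continuous_on {A :: real^'n^'n. invertible A} matrix_inv"
proof -
  have nz: "\<forall>A\<in>{A :: real^'n^'n. invertible A}.
      (\<Sum>p | p permutes UNIV. of_int (sign p) * (\<Prod>i\<in>UNIV. A $ i $ p i)) \<noteq> 0"
    by (auto simp: invertible_det_nz det_def)
  \<comment> \<open>Whether an entry of the numerator matrix is a constant or an entry of
    \<open>A\<close> depends on its position only, so the conditional does not disturb
    continuity.\<close>
  have if_cont: "continuous_on S (\<lambda>A :: real^'n^'n. if P then c else A $ a $ b)" for S P c a b
    by (cases P) (auto intro!: continuous_intros)
  have "continuous_on {A :: real^'n^'n. invertible A}
    (\<lambda>A. \<chi> i j. det (\<chi> a b. if b = i then axis j 1 $ a else A $ a $ b) / det A)"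
    unfolding det_def using nz
    by (intro continuous_intros if_cont)
  then show ?thesis
    by (rule continuous_on_eq) (simp add: matrix_inv_cramer)
qed

section \<open>Positive definite matrices and least squares coefficients\<close>

lemma sym_pos_def_imp_invertible:
  fixes A :: "real^'n^'n"
  assumes "sym_pos_def A"
  shows "invertible A"
  using assms unfolding sym_pos_def_def invertible_left_inverse matrix_left_invertible_ker
  by (metis inner_zero_right less_irrefl)

text \<open>The quadratic form at \<open>v\<close> is that of \<open>A\<close> at
  \<open>D *v v\<close>, which is nonzero by injectivity. This yields invertibility both of the
  normal matrix of least squares and of the information of a transformed score.\<close>

lemma sym_pos_def_congruence:
  fixes A :: "real^'n^'n" and D :: "real^'m^'n"
  assumes "sym_pos_def A" "inj ((*v) D)"
  shows "sym_pos_def (transpose D ** A ** D)"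
proof -
  have "v \<bullet> ((transpose D ** A ** D) *v v) = (D *v v) \<bullet> (A *v (D *v v))" for v
    by (metis dot_lmul_matrix matrix_mul_assoc matrix_vector_mul_assoc transpose_matrix_vector
        inner_commute)
  moreover have "D *v v \<noteq> 0" if "v \<noteq> 0" for v
    using assms(2) that by (metis injD matrix_vector_mult_0_right)
  ultimately show ?thesis
    using assms(1) by (simp add: sym_pos_def_def matrix_transpose_mul matrix_mul_assoc)
qed

text \<open>The coefficient matrix of the weighted least squares estimator with design matrix \<open>D\<close>
  and weight matrix \<open>A\<close>.\<close>

definition wls :: "real^'m^'n \<Rightarrow> real^'n^'n \<Rightarrow> real^'n^'m" where
  "wls D A = matrix_inv (transpose D ** A ** D) ** transpose D ** A"

text \<open>Least squares is exact on the column space of \<open>D\<close>; this is what later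
  cancels the preliminary estimator to first order.\<close>

lemma wls_mult_left:
  assumes "sym_pos_def A" "inj ((*v) D)"
  shows "wls D A ** D = mat 1"
  using sym_pos_def_imp_invertible[OF sym_pos_def_congruence[OF assms]]
  unfolding wls_def by (metis matrix_inv_left matrix_mul_assoc)

text \<open>Joint continuity lets \<open>wls\<close> inherit limits in probability from its two
  arguments; on the given set the normal matrix is invertible.\<close>

lemma continuous_on_wls:
  "continuous_on {(D, A). sym_pos_def A \<and> inj ((*v) D)} (\<lambda>(D, A). wls D A)"
proof -
  note [continuous_intros] =
    bounded_bilinear.continuous_on[OF bounded_bilinear_matrix_matrix_mult]
    bounded_linear.continuous_on[OF bounded_linear_transpose]
  show ?thesis
    unfolding wls_def case_prod_beta
    by (intro continuous_intros continuous_on_compose2[OF continuous_on_matrix_inv])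
       (auto intro: sym_pos_def_imp_invertible sym_pos_def_congruence)
qed

section \<open>Square-integrable functions and information\<close>

lemma square_norm_bound:
  fixes g a b :: real
  assumes "0 \<le> g" "g \<le> a + b"
  shows "g\<^sup>2 \<le> 2 * a\<^sup>2 + 2 * b\<^sup>2"
proof -
  have "g\<^sup>2 \<le> (a + b)\<^sup>2" using assms by (intro power_mono)
  also have "\<dots> \<le> 2 * a\<^sup>2 + 2 * b\<^sup>2"
    using zero_le_power2[of "a - b"] by (simp add: power2_eq_square algebra_simps)
  finally show ?thesis .
qed

lemma L2norm_nonneg: "0 \<le> L2norm \<mu> g"
  by (simp add: L2norm_def)

lemma integrable_square_le:
  fixes g :: "'a \<Rightarrow> 'b::real_normed_vector"
    and a :: "'a \<Rightarrow> 'c::real_normed_vector" and b :: "'a \<Rightarrow> 'd::real_normed_vector"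
  assumes "(\<lambda>x. norm (g x)) \<in> borel_measurable \<mu>"
    and "integrable \<mu> (\<lambda>x. (norm (a x))\<^sup>2)" "integrable \<mu> (\<lambda>x. (norm (b x))\<^sup>2)"
    and "\<And>x. norm (g x) \<le> c * norm (a x) + d * norm (b x)"
  shows "integrable \<mu> (\<lambda>x. (norm (g x))\<^sup>2)"
proof (rule Bochner_Integration.integrable_bound)
  show "integrable \<mu> (\<lambda>x. 2 * c\<^sup>2 * (norm (a x))\<^sup>2 + 2 * d\<^sup>2 * (norm (b x))\<^sup>2)"
    using assms(2,3) by simp
  show "(\<lambda>x. (norm (g x))\<^sup>2) \<in> borel_measurable \<mu>"
    using assms(1) by simp
  show "AE x in \<mu>. norm ((norm (g x))\<^sup>2) \<le>
      norm (2 * c\<^sup>2 * (norm (a x))\<^sup>2 + 2 * d\<^sup>2 * (norm (b x))\<^sup>2)"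
    using square_norm_bound[OF norm_ge_zero assms(4)] by (simp add: power_mult_distrib mult.assoc)
qed

text \<open>A substitute for Minkowski's inequality based on \<open>square_norm_bound\<close>. The
  extra factor 2 is harmless where only orders of magnitude and limits to 0 matter.\<close>

lemma L2norm_le:
  fixes g :: "'a \<Rightarrow> 'b::real_normed_vector"
    and a :: "'a \<Rightarrow> 'c::real_normed_vector" and b :: "'a \<Rightarrow> 'd::real_normed_vector"
  assumes "integrable \<mu> (\<lambda>x. (norm (a x))\<^sup>2)" "integrable \<mu> (\<lambda>x. (norm (b x))\<^sup>2)"
    and "\<And>x. norm (g x) \<le> c * norm (a x) + d * norm (b x)" "0 \<le> c" "0 \<le> d"
  shows "L2norm \<mu> g \<le> 2 * (c * L2norm \<mu> a + d * L2norm \<mu> b)"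
proof -
  let ?A = "\<integral>x. (norm (a x))\<^sup>2 \<partial>\<mu>" and ?B = "\<integral>x. (norm (b x))\<^sup>2 \<partial>\<mu>"
  \<comment> \<open>If the square of \<open>g\<close> is not integrable, the left side is 0 by
    default; \<open>integral_mono'\<close> covers this case too.\<close>
  have "(\<integral>x. (norm (g x))\<^sup>2 \<partial>\<mu>) \<le>
      (\<integral>x. 2 * c\<^sup>2 * (norm (a x))\<^sup>2 + 2 * d\<^sup>2 * (norm (b x))\<^sup>2 \<partial>\<mu>)"
    using assms(1,2) square_norm_bound[OF norm_ge_zero assms(3)]
    by (intro integral_mono') (auto simp: power_mult_distrib mult.assoc)
  also have "\<dots> = 2 * c\<^sup>2 * ?A + 2 * d\<^sup>2 * ?B"
    using assms(1,2) by simp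
  also have "\<dots> \<le> (2 * (c * sqrt ?A + d * sqrt ?B))\<^sup>2"
    using assms(4,5) by (simp add: power2_eq_square algebra_simps)
  finally show ?thesis
    using assms(4,5) unfolding L2norm_def by (intro real_le_lsqrt) auto
qed

lemma square_integrable_matrix_vector_mult:
  assumes "square_integrable \<mu> l"
  shows "square_integrable \<mu> (\<lambda>x. (A :: real^'n^'m) *v l x)"
  unfolding square_integrable_def
proof
  show meas: "(\<lambda>x. A *v l x) \<in> borel_measurable \<mu>"
    using assms unfolding square_integrable_def
    by (intro borel_measurable_continuous_on[OF matrix_vector_mult_linear_continuous_on]) simp
  show "integrable \<mu> (\<lambda>x. (norm (A *v l x))\<^sup>2)"
  proof (rule integrable_square_le)
    show "norm (A *v l x) \<le> norm A * norm (l x) + 0 * norm (l x)" for x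
      by (simp add: norm_matrix_vector_mult_le)
    show "integrable \<mu> (\<lambda>x. (norm (l x))\<^sup>2)" "integrable \<mu> (\<lambda>x. (norm (l x))\<^sup>2)"
      using assms by (simp_all add: square_integrable_def)
    show "(\<lambda>x. norm (A *v l x)) \<in> borel_measurable \<mu>"
      using meas by (rule measurable_compose[OF _ borel_measurable_norm])
  qed
qed

section \<open>Information matrices of square-integrable scores\<close>

lemma square_integrable_measurable_component:
  assumes "square_integrable P l"
  shows "(\<lambda>x. l x $ i) \<in> borel_measurable P"
  using assms unfolding square_integrable_def
  by (rule measurable_compose[OF conjunct1 borel_measurable_nth])

lemma square_integrable_component_product:
  assumes "square_integrable P l"
  shows "integrable P (\<lambda>x. l x $ i * l x $ j)"
proof (rule Bochner_Integration.integrable_bound)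
  show "integrable P (\<lambda>x. (norm (l x))\<^sup>2)" "(\<lambda>x. l x $ i * l x $ j) \<in> borel_measurable P"
    using assms square_integrable_measurable_component[OF assms]
    by (auto simp: square_integrable_def)
  show "AE x in P. norm (l x $ i * l x $ j) \<le> norm ((norm (l x))\<^sup>2)"
    unfolding power2_eq_square norm_mult real_norm_def abs_norm_cancel abs_mult
    by (intro AE_I2 mult_mono component_le_norm_cart) auto
qed

text \<open>Linearity of the integral, applied to a double sum of integrable products. With a
  transposed Jacobian as \<open>A\<close> it gives the information of a score obtained by the chain
  rule.\<close>

lemma information_matrix_vector_mult:
  fixes l :: "'a \<Rightarrow> real^'n" and A :: "real^'n^'m"
  assumes "square_integrable P l"
  shows "information P (\<lambda>x. A *v l x) = A ** information P l ** transpose A"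
proof -
  have "information P (\<lambda>x. A *v l x) $ i $ j =
      (\<Sum>a\<in>UNIV. \<Sum>b\<in>UNIV. A $ i $ a * A $ j $ b * information P l $ a $ b)" for i j
  proof -
    have "(A *v l x) $ i * (A *v l x) $ j =
        (\<Sum>a\<in>UNIV. \<Sum>b\<in>UNIV. A $ i $ a * A $ j $ b * (l x $ a * l x $ b))" for x
      by (simp add: matrix_vector_mult_def sum_product mult_ac)
    then show ?thesis
      by (simp add: information_def square_integrable_component_product[OF assms])
  qed
  moreover have "(A ** information P l ** transpose A) $ i $ j =
      (\<Sum>a\<in>UNIV. \<Sum>b\<in>UNIV. A $ i $ a * A $ j $ b * information P l $ a $ b)" for i j
    unfolding matrix_matrix_mult_def transpose_def
    by (simp add: sum_distrib_right sum_distrib_left mult_ac) (rule sum.swap)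
  ultimately show ?thesis
    by (simp add: vec_eq_iff)
qed

text \<open>The quadratic form at \<open>v\<close> is the second moment of
  \<open>v \<bullet> l x\<close>. If it vanishes, then \<open>v \<bullet> l x\<close> is 0 almost
  everywhere, so the information matrix annihilates \<open>v\<close>, which contradicts
  invertibility.\<close>

lemma sym_pos_def_information:
  fixes l :: "'a \<Rightarrow> real^'n"
  assumes l: "square_integrable P l" and inv: "invertible (information P l)"
  shows "sym_pos_def (information P l)"
  unfolding sym_pos_def_def
proof (intro conjI allI impI)
  show "transpose (information P l) = information P l"
    by (simp add: transpose_def information_def vec_eq_iff mult.commute)
  fix v :: "real^'n"
  assume "v \<noteq> 0"
  let ?q = "\<lambda>x. v \<bullet> l x"
  note int = square_integrable_component_product[OF l]
  have q2: "(?q x)\<^sup>2 = (\<Sum>i\<in>UNIV. \<Sum>j\<in>UNIV. v $ i * v $ j * (l x $ i * l x $ j))" for x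
    by (simp add: inner_vec_def power2_eq_square sum_product mult_ac)
  have integrable_q2: "integrable P (\<lambda>x. (?q x)\<^sup>2)"
    unfolding q2 using int by simp
  have quad: "v \<bullet> (information P l *v v) = (\<integral>x. (?q x)\<^sup>2 \<partial>P)"
    unfolding q2 using int
    by (simp add: inner_vec_def matrix_vector_mult_def information_def sum_distrib_left mult_ac)
  have "v \<bullet> (information P l *v v) \<noteq> 0"
  proof
    assume "v \<bullet> (information P l *v v) = 0"
    then have q0: "AE x in P. ?q x = 0"
      using integral_nonneg_eq_0_iff_AE[OF integrable_q2] quad by simp
    have "(information P l *v v) $ i = 0" for i
    proof -
      have "(information P l *v v) $ i = (\<integral>x. l x $ i * ?q x \<partial>P)"
        using int by (simp add: inner_vec_def matrix_vector_mult_def information_def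
            sum_distrib_left mult_ac)
      also have "\<dots> = (\<integral>x. 0 \<partial>P)"
        using q0 l square_integrable_measurable_component[OF l]
        by (intro integral_cong_AE) (auto simp: square_integrable_def)
      finally show ?thesis by simp
    qed
    then have "information P l *v v = 0"
      by (simp add: vec_eq_iff)
    with inv \<open>v \<noteq> 0\<close> show False
      by (metis invertible_left_inverse matrix_left_invertible_ker)
  qed
  moreover have "0 \<le> v \<bullet> (information P l *v v)"
    unfolding quad by simp
  ultimately show "0 < v \<bullet> (information P l *v v)"
    by simp
qed

lemma square_integrable_diff:
  assumes "square_integrable P g" "square_integrable P h"
  shows "square_integrable P (\<lambda>x. g x - h x)"
  unfolding square_integrable_def
proof
  show meas: "(\<lambda>x. g x - h x) \<in> borel_measurable P"
    using assms unfolding square_integrable_def by (intro borel_measurable_diff) simp_all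
  have bound: "norm (g x - h x) \<le> 1 * norm (g x) + 1 * norm (h x)" for x
    unfolding mult_1 by (rule norm_triangle_ineq4)
  show "integrable P (\<lambda>x. (norm (g x - h x))\<^sup>2)"
    using assms unfolding square_integrable_def
    by (intro integrable_square_le[OF measurable_compose[OF meas borel_measurable_norm] _ _ bound])
       simp_all
qed

lemma L2norm_matrix_vector_mult_le:
  fixes A :: "real^'n^'m"
  assumes "square_integrable P g"
  shows "L2norm P (\<lambda>x. A *v g x) \<le> 2 * norm A * L2norm P g"
proof -
  have int: "integrable P (\<lambda>x. (norm (g x))\<^sup>2)"
    using assms by (simp add: square_integrable_def)
  have "norm (A *v g x) \<le> norm A * norm (g x) + 0 * norm (g x)" for x
    by (simp add: norm_matrix_vector_mult_le)
  from L2norm_le[OF int int this] show ?thesis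
    by simp
qed

section \<open>Reparametrized submodels\<close>

text \<open>Integrating against \<open>P\<close> means integrating against \<open>\<mu>\<close> with
  weight \<open>p\<close>: total mass and second moment of the score turn into squared norms of the
  root density and of the weighted score.\<close>

lemma model_root_density_integrable:
  fixes s :: "'a \<Rightarrow> real^'k"
  assumes P: "P = density \<mu> (\<lambda>x. ennreal (p x))" and "prob_space P"
    and p[measurable]: "p \<in> borel_measurable \<mu>" and "\<And>x. 0 \<le> p x"
    and s: "square_integrable P s"
  shows "integrable \<mu> (\<lambda>x. (norm (sqrt (p x)))\<^sup>2)"
    and "(\<lambda>x. sqrt (p x) *\<^sub>R s x) \<in> borel_measurable \<mu>"
    and "integrable \<mu> (\<lambda>x. (norm (sqrt (p x) *\<^sub>R s x))\<^sup>2)"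
proof -
  interpret P: prob_space P by fact
  have "integrable P (\<lambda>x. 1 :: real)" by simp
  then show "integrable \<mu> (\<lambda>x. (norm (sqrt (p x)))\<^sup>2)"
    using assms(4) unfolding P by (subst (asm) integrable_density) auto
  have sm[measurable]: "s \<in> borel_measurable \<mu>"
    using s unfolding P square_integrable_def by simp
  show "(\<lambda>x. sqrt (p x) *\<^sub>R s x) \<in> borel_measurable \<mu>"
    by measurable
  have "integrable P (\<lambda>x. (norm (s x))\<^sup>2)"
    using s by (simp add: square_integrable_def)
  then show "integrable \<mu> (\<lambda>x. (norm (sqrt (p x) *\<^sub>R s x))\<^sup>2)"
    using assms(4) unfolding P by (subst (asm) integrable_density) (auto simp: power_mult_distrib)
qed

text \<open>The filter \<open>at\<close> excludes its center, so substituting \<open>f \<nu>\<close>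
  into a limit at \<open>f \<nu>\<close> requires that no other point of \<open>N\<close> is sent to
  the center.\<close>

lemma filterlim_at_within_injective:
  assumes "continuous_on N f" "inj_on f N" "f ` N \<subseteq> \<Theta>" "\<nu> \<in> N"
  shows "filterlim f (at (f \<nu>) within \<Theta>) (at \<nu> within N)"
  unfolding filterlim_at
proof
  show "\<forall>\<^sub>F x in at \<nu> within N. f x \<in> \<Theta> \<and> f x \<noteq> f \<nu>"
    using assms(2-4) by (auto simp: eventually_at_filter inj_on_def intro!: always_eventually)
  show "(f \<longlongrightarrow> f \<nu>) (at \<nu> within N)"
    using assms(1,4) by (simp add: continuous_on_def)
qed

text \<open>Dominating measure and densities are kept, the latter composed with \<open>f\<close>.
  Hellinger differentiability follows from the chain rule, continuity from a telescoping difference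
  of products, and nonsingularity from congruence with the injective Jacobian.\<close>

lemma regular_parametric_model_score_reparametrize:
  fixes f :: "real^'d \<Rightarrow> real^'k" and Df :: "real^'d \<Rightarrow> real^'d^'k"
  assumes model: "regular_parametric_model_score M \<Theta> P s"
    and "open N" and fN: "f ` N \<subseteq> \<Theta>" and f_inj: "inj_on f N"
    and deriv: "\<And>\<nu>. \<nu> \<in> N \<Longrightarrow> (f has_derivative (\<lambda>h. Df \<nu> *v h)) (at \<nu>)"
    and Df_cont: "continuous_on N Df"
    and Df_inj: "\<And>\<nu>. \<nu> \<in> N \<Longrightarrow> inj ((*v) (Df \<nu>))"
  shows "regular_parametric_model_score M N (\<lambda>\<nu>. P (f \<nu>)) (\<lambda>\<nu> x. transpose (Df \<nu>) *v s (f \<nu>) x)"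
proof -
  \<comment> \<open>Brings a remainder plus half an inner product into the form required by
    \<open>L2norm_le\<close>; the factor 1/2 in the bound is given away.\<close>
  have add_half: "norm (h + q / 2) \<le> 1 * norm h + B" if "norm q \<le> B" for h q B :: real
    using that by simp
  have f_cont: "continuous_on N f"
    using deriv by (meson continuous_at_imp_continuous_on has_derivative_continuous)
  have fT: "f \<nu> \<in> \<Theta>" if "\<nu> \<in> N" for \<nu> using fN that by auto
  have P: "prob_space (P \<theta>)" "sets (P \<theta>) = sets M" "square_integrable (P \<theta>) (s \<theta>)"
    if "\<theta> \<in> \<Theta>" for \<theta>
    using model that by (auto simp: regular_parametric_model_score_def)
  define rem where "rem p \<theta>0 \<theta> x = sqrt (p \<theta> x) - sqrt (p \<theta>0 x)
      - 1/2 * ((\<theta> - \<theta>0) \<bullet> s \<theta>0 x) * sqrt (p \<theta>0 x)" for p :: "real^'k \<Rightarrow> 'a \<Rightarrow> real" and \<theta>0 \<theta> x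
  from model obtain \<mu> p where \<mu>: "sigma_finite_measure \<mu>" "sets \<mu> = sets M"
    and p: "\<And>\<theta>. \<theta> \<in> \<Theta> \<Longrightarrow> p \<theta> \<in> borel_measurable \<mu>" "\<And>\<theta> x. \<theta> \<in> \<Theta> \<Longrightarrow> 0 \<le> p \<theta> x"
      "\<And>\<theta>. \<theta> \<in> \<Theta> \<Longrightarrow> P \<theta> = density \<mu> (\<lambda>x. ennreal (p \<theta> x))"
    and hellinger: "\<And>\<theta>0. \<theta>0 \<in> \<Theta> \<Longrightarrow>
      (\<lambda>\<theta>. L2norm \<mu> (rem p \<theta>0 \<theta>)) \<in> o[at \<theta>0 within \<Theta>](\<lambda>\<theta>. norm (\<theta> - \<theta>0))"
    and info: "\<And>\<theta>0. \<theta>0 \<in> \<Theta> \<Longrightarrow> invertible (information (P \<theta>0) (s \<theta>0))"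
    and score_cont: "\<And>\<theta>0. \<theta>0 \<in> \<Theta> \<Longrightarrow>
      ((\<lambda>\<theta>. L2norm \<mu> (\<lambda>x. sqrt (p \<theta> x) *\<^sub>R s \<theta> x - sqrt (p \<theta>0 x) *\<^sub>R s \<theta>0 x)) \<longlongrightarrow> 0) (at \<theta>0 within \<Theta>)"
    unfolding regular_parametric_model_score_def rem_def by blast
  have root: "integrable \<mu> (\<lambda>x. (norm (sqrt (p \<theta> x)))\<^sup>2)"
      "(\<lambda>x. sqrt (p \<theta> x) *\<^sub>R s \<theta> x) \<in> borel_measurable \<mu>"
      "integrable \<mu> (\<lambda>x. (norm (sqrt (p \<theta> x) *\<^sub>R s \<theta> x))\<^sup>2)" if "\<theta> \<in> \<Theta>" for \<theta>
    using model_root_density_integrable[OF p(3) P(1) p(1) p(2) P(3)] that by auto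
  have rem_meas: "rem p \<theta>0 \<theta> \<in> borel_measurable \<mu>" if "\<theta>0 \<in> \<Theta>" "\<theta> \<in> \<Theta>" for \<theta>0 \<theta>
  proof -
    \<comment> \<open>Moving the root density into the inner product exposes the weighted score,
      whose measurability and integrability over \<open>\<mu>\<close> are provided by
      \<open>root\<close>.\<close>
    have "rem p \<theta>0 \<theta> = (\<lambda>x. sqrt (p \<theta> x) - sqrt (p \<theta>0 x)
        - 1/2 * ((\<theta> - \<theta>0) \<bullet> (sqrt (p \<theta>0 x) *\<^sub>R s \<theta>0 x)))"
      by (simp add: rem_def fun_eq_iff)
    moreover note [measurable] = p(1)[OF that(1)] p(1)[OF that(2)] root(2)[OF that(1)]
    have "(\<lambda>x. sqrt (p \<theta> x) - sqrt (p \<theta>0 x)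
        - 1/2 * ((\<theta> - \<theta>0) \<bullet> (sqrt (p \<theta>0 x) *\<^sub>R s \<theta>0 x))) \<in> borel_measurable \<mu>"
      by measurable
    ultimately show ?thesis
      by metis
  qed
  \<comment> \<open>A small \<open>L2norm\<close> says something only for square-integrable
    functions, since it is 0 by default otherwise; \<open>L2norm_le\<close> therefore asks for
    this.\<close>
  have rem_int: "integrable \<mu> (\<lambda>x. (norm (rem p \<theta>0 \<theta> x))\<^sup>2)"
    if \<theta>: "\<theta>0 \<in> \<Theta>" "\<theta> \<in> \<Theta>" for \<theta>0 \<theta>
  proof -
    let ?h = "\<lambda>x. sqrt (p \<theta> x) - sqrt (p \<theta>0 x)"
    have h: "integrable \<mu> (\<lambda>x. (norm (?h x))\<^sup>2)"
      using p(1)[OF \<theta>(1)] p(1)[OF \<theta>(2)]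
      by (intro integrable_square_le[OF _ root(1)[OF \<theta>(2)] root(1)[OF \<theta>(1)], of _ 1 1]) auto
    have bound: "norm (rem p \<theta>0 \<theta> x) \<le>
        1 * norm (?h x) + norm (\<theta> - \<theta>0) * norm (sqrt (p \<theta>0 x) *\<^sub>R s \<theta>0 x)" for x
    proof -
      have "rem p \<theta>0 \<theta> x = ?h x + (- ((\<theta> - \<theta>0) \<bullet> (sqrt (p \<theta>0 x) *\<^sub>R s \<theta>0 x))) / 2"
        by (simp add: rem_def)
      moreover have "norm (- ((\<theta> - \<theta>0) \<bullet> (sqrt (p \<theta>0 x) *\<^sub>R s \<theta>0 x))) \<le>
          norm (\<theta> - \<theta>0) * norm (sqrt (p \<theta>0 x) *\<^sub>R s \<theta>0 x)"
        unfolding norm_minus_cancel by (rule Cauchy_Schwarz_ineq2[folded real_norm_def])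
      ultimately show ?thesis
        using add_half by metis
    qed
    show ?thesis
      by (rule integrable_square_le[OF _ h root(3)[OF \<theta>(1)] bound])
         (rule measurable_compose[OF rem_meas[OF \<theta>] borel_measurable_norm])
  qed
  have hellinger': "(\<lambda>\<nu>. L2norm \<mu> (\<lambda>x. sqrt (p (f \<nu>) x) - sqrt (p (f \<nu>0) x)
        - 1/2 * ((\<nu> - \<nu>0) \<bullet> (transpose (Df \<nu>0) *v s (f \<nu>0) x)) * sqrt (p (f \<nu>0) x)))
      \<in> o[at \<nu>0 within N](\<lambda>\<nu>. norm (\<nu> - \<nu>0))" (is "(\<lambda>\<nu>. L2norm \<mu> (?rem \<nu>)) \<in> _")
    if \<nu>0: "\<nu>0 \<in> N" for \<nu>0
  proof -
    let ?F = "at \<nu>0 within N" and ?\<theta>0 = "f \<nu>0"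
    let ?c = "L2norm \<mu> (\<lambda>x. sqrt (p ?\<theta>0 x) *\<^sub>R s ?\<theta>0 x)"
    \<comment> \<open>The linearization error of \<open>f\<close> at \<open>\<nu>0\<close>. Its
      smallness also shows that \<open>f \<nu> - f \<nu>0\<close> is of order
      \<open>\<nu> - \<nu>0\<close>, which converts rates in \<open>\<theta>\<close> into rates in
      \<open>\<nu>\<close>.\<close>
    define r where "r \<nu> = f \<nu> - f \<nu>0 - Df \<nu>0 *v (\<nu> - \<nu>0)" for \<nu>
    have r_small: "(\<lambda>\<nu>. norm (r \<nu>)) \<in> o[?F](\<lambda>\<nu>. norm (\<nu> - \<nu>0))"
    proof (rule smalloI_tendsto)
      have "((\<lambda>\<nu>. norm ((1 / norm (\<nu> - \<nu>0)) *\<^sub>R (f \<nu> - (f \<nu>0 + Df \<nu>0 *v (\<nu> - \<nu>0))))) \<longlongrightarrow> 0) ?F"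
        using has_derivative_at_withinI[OF deriv[OF \<nu>0], of N]
        by (intro tendsto_norm_zero) (simp add: has_derivative_within)
      then show "((\<lambda>\<nu>. norm (r \<nu>) / norm (\<nu> - \<nu>0)) \<longlongrightarrow> 0) ?F"
        by (simp add: r_def diff_diff_eq)
      show "\<forall>\<^sub>F \<nu> in ?F. norm (\<nu> - \<nu>0) \<noteq> 0"
        by (simp add: eventually_at_filter)
    qed
    have "(\<lambda>\<nu>. norm (f \<nu> - ?\<theta>0)) \<in> O[?F](\<lambda>\<nu>. norm (r \<nu>) + norm (Df \<nu>0) * norm (\<nu> - \<nu>0))"
    proof (intro landau_o.big_mono always_eventually allI)
      fix \<nu>
      have "f \<nu> - ?\<theta>0 = r \<nu> + Df \<nu>0 *v (\<nu> - \<nu>0)"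
        by (simp add: r_def)
      then show "norm (norm (f \<nu> - ?\<theta>0)) \<le> norm (norm (r \<nu>) + norm (Df \<nu>0) * norm (\<nu> - \<nu>0))"
        using norm_triangle_ineq[of "r \<nu>" "Df \<nu>0 *v (\<nu> - \<nu>0)"]
          norm_matrix_vector_mult_le[of "Df \<nu>0" "\<nu> - \<nu>0"] by simp
    qed
    also have "(\<lambda>\<nu>. norm (r \<nu>) + norm (Df \<nu>0) * norm (\<nu> - \<nu>0)) \<in> O[?F](\<lambda>\<nu>. norm (\<nu> - \<nu>0))"
      using landau_o.small_imp_big[OF r_small] by (intro sum_in_bigo) auto
    finally have f_big: "(\<lambda>\<nu>. norm (f \<nu> - ?\<theta>0)) \<in> O[?F](\<lambda>\<nu>. norm (\<nu> - \<nu>0))" .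
    have "(\<lambda>\<nu>. L2norm \<mu> (rem p ?\<theta>0 (f \<nu>))) \<in> o[?F](\<lambda>\<nu>. norm (f \<nu> - ?\<theta>0))"
      using hellinger[OF fT[OF \<nu>0]] filterlim_at_within_injective[OF f_cont f_inj fN \<nu>0]
      by (rule landau_o.small.compose)
    then have rem_small: "(\<lambda>\<nu>. L2norm \<mu> (rem p ?\<theta>0 (f \<nu>))) \<in> o[?F](\<lambda>\<nu>. norm (\<nu> - \<nu>0))"
      using f_big by (rule landau_o.small_big_trans)
    have "(\<lambda>\<nu>. L2norm \<mu> (?rem \<nu>)) \<in>
        O[?F](\<lambda>\<nu>. 2 * (1 * L2norm \<mu> (rem p ?\<theta>0 (f \<nu>)) + norm (r \<nu>) * ?c))"
    proof (rule landau_o.big_mono)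
      have "L2norm \<mu> (?rem \<nu>) \<le> 2 * (1 * L2norm \<mu> (rem p ?\<theta>0 (f \<nu>)) + norm (r \<nu>) * ?c)"
        if \<nu>: "\<nu> \<in> N" for \<nu>
      proof (rule L2norm_le)
        fix x
        have key: "(\<nu> - \<nu>0) \<bullet> (transpose (Df \<nu>0) *v s ?\<theta>0 x) = (Df \<nu>0 *v (\<nu> - \<nu>0)) \<bullet> s ?\<theta>0 x"
          by (metis dot_lmul_matrix inner_commute transpose_matrix_vector)
        have r: "r \<nu> \<bullet> (sqrt (p ?\<theta>0 x) *\<^sub>R s ?\<theta>0 x) = sqrt (p ?\<theta>0 x) *
            ((f \<nu> - ?\<theta>0) \<bullet> s ?\<theta>0 x - (Df \<nu>0 *v (\<nu> - \<nu>0)) \<bullet> s ?\<theta>0 x)"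
          by (simp add: r_def inner_diff_left)
        \<comment> \<open>Here \<open>a\<close> and \<open>b\<close> are the inner products of the
          score with the true increment of \<open>f\<close> and with its linearization, so
          \<open>a - b\<close> is the inner product with \<open>r \<nu>\<close>.\<close>
        have "h - 1/2 * b * q = (h - 1/2 * a * q) + (q * (a - b)) / 2" for h a b q :: real
          by (simp add: field_simps)
        then have "?rem \<nu> x = rem p ?\<theta>0 (f \<nu>) x + (r \<nu> \<bullet> (sqrt (p ?\<theta>0 x) *\<^sub>R s ?\<theta>0 x)) / 2"
          unfolding rem_def key r .
        then show "norm (?rem \<nu> x) \<le> 1 * norm (rem p ?\<theta>0 (f \<nu>) x)
            + norm (r \<nu>) * norm (sqrt (p ?\<theta>0 x) *\<^sub>R s ?\<theta>0 x)"
          using add_half[OF Cauchy_Schwarz_ineq2[folded real_norm_def]] by metis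
      qed (use rem_int root(3) fT \<nu> \<nu>0 in auto)
      then show "\<forall>\<^sub>F \<nu> in ?F. norm (L2norm \<mu> (?rem \<nu>)) \<le>
          norm (2 * (1 * L2norm \<mu> (rem p ?\<theta>0 (f \<nu>)) + norm (r \<nu>) * ?c))"
        by (auto simp: eventually_at_filter L2norm_nonneg intro!: always_eventually)
    qed
    also have "(\<lambda>\<nu>. 2 * (1 * L2norm \<mu> (rem p ?\<theta>0 (f \<nu>)) + norm (r \<nu>) * ?c)) \<in> o[?F](\<lambda>\<nu>. norm (\<nu> - \<nu>0))"
      using rem_small r_small by (simp add: distrib_left sum_in_smallo mult_ac)
    finally show ?thesis .
  qed
  have Df_transpose_cont: "continuous_on N (\<lambda>\<nu>. transpose (Df \<nu>))"
    using Df_cont by (rule bounded_linear.continuous_on[OF bounded_linear_transpose])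
  have score_cont': "((\<lambda>\<nu>. L2norm \<mu> (\<lambda>x. sqrt (p (f \<nu>) x) *\<^sub>R (transpose (Df \<nu>) *v s (f \<nu>) x)
        - sqrt (p (f \<nu>0) x) *\<^sub>R (transpose (Df \<nu>0) *v s (f \<nu>0) x))) \<longlongrightarrow> 0) (at \<nu>0 within N)"
      (is "((\<lambda>\<nu>. L2norm \<mu> (?d \<nu>)) \<longlongrightarrow> 0) _")
    if \<nu>0: "\<nu>0 \<in> N" for \<nu>0
  proof -
    let ?w = "\<lambda>\<theta> x. sqrt (p \<theta> x) *\<^sub>R s \<theta> x"
    let ?T = "\<lambda>\<nu>. transpose (Df \<nu>)"
    let ?b = "\<lambda>\<nu>. 2 * (norm (?T \<nu>) * L2norm \<mu> (\<lambda>x. ?w (f \<nu>) x - ?w (f \<nu>0) x)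
        + norm (?T \<nu> - ?T \<nu>0) * L2norm \<mu> (?w (f \<nu>0)))"
    have T: "(?T \<longlongrightarrow> ?T \<nu>0) (at \<nu>0 within N)"
      using Df_transpose_cont \<nu>0 by (simp add: continuous_on_def)
    have "((\<lambda>\<nu>. L2norm \<mu> (\<lambda>x. ?w (f \<nu>) x - ?w (f \<nu>0) x)) \<longlongrightarrow> 0) (at \<nu>0 within N)"
      using score_cont[OF fT[OF \<nu>0]] filterlim_at_within_injective[OF f_cont f_inj fN \<nu>0]
      by (rule filterlim_compose)
    then have "(?b \<longlongrightarrow> 2 * (norm (?T \<nu>0) * 0 + norm (?T \<nu>0 - ?T \<nu>0) * L2norm \<mu> (?w (f \<nu>0)))) (at \<nu>0 within N)"
      by (intro tendsto_intros T)
    then have lim: "(?b \<longlongrightarrow> 0) (at \<nu>0 within N)"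
      by simp
    have bound: "L2norm \<mu> (?d \<nu>) \<le> ?b \<nu>" if \<nu>: "\<nu> \<in> N" for \<nu>
    proof (rule L2norm_le)
      fix x
      \<comment> \<open>Telescoping: the first summand is small by continuity of the weighted score,
        the second by continuity of the Jacobian.\<close>
      have "?d \<nu> x = ?T \<nu> *v (?w (f \<nu>) x - ?w (f \<nu>0) x) + (?T \<nu> - ?T \<nu>0) *v ?w (f \<nu>0) x"
        by (simp add: algebra_simps del: transpose_matrix_vector)
      then show "norm (?d \<nu> x) \<le> norm (?T \<nu>) * norm (?w (f \<nu>) x - ?w (f \<nu>0) x)
          + norm (?T \<nu> - ?T \<nu>0) * norm (?w (f \<nu>0) x)"
        using norm_triangle_le[OF add_mono[OF norm_matrix_vector_mult_le norm_matrix_vector_mult_le]]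
        by metis
    next
      have "norm (?w (f \<nu>) x - ?w (f \<nu>0) x) \<le> 1 * norm (?w (f \<nu>) x) + 1 * norm (?w (f \<nu>0) x)" for x
        unfolding mult_1 by (rule norm_triangle_ineq4)
      note bound = this
      note [measurable] = root(2)[OF fT[OF \<nu>]] root(2)[OF fT[OF \<nu>0]]
      show "integrable \<mu> (\<lambda>x. (norm (?w (f \<nu>) x - ?w (f \<nu>0) x))\<^sup>2)"
        by (rule integrable_square_le[OF _ root(3)[OF fT[OF \<nu>]] root(3)[OF fT[OF \<nu>0]] bound])
           measurable
      show "integrable \<mu> (\<lambda>x. (norm (?w (f \<nu>0) x))\<^sup>2)"
        using root(3)[OF fT[OF \<nu>0]] .
    qed auto
    show ?thesis
      by (rule Lim_null_comparison[OF _ lim])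
         (use bound in \<open>auto simp: eventually_at_filter L2norm_nonneg intro!: always_eventually\<close>)
  qed
  have info': "invertible (information (P (f \<nu>)) (\<lambda>x. transpose (Df \<nu>) *v s (f \<nu>) x))"
    if \<nu>: "\<nu> \<in> N" for \<nu>
    using sym_pos_def_imp_invertible[OF sym_pos_def_congruence[OF
          sym_pos_def_information[OF P(3)[OF fT[OF \<nu>]] info[OF fT[OF \<nu>]]] Df_inj[OF \<nu>]]]
    unfolding information_matrix_vector_mult[OF P(3)[OF fT[OF \<nu>]]] transpose_transpose .
  show ?thesis
    unfolding regular_parametric_model_score_def
    using \<open>open N\<close> P fT \<mu> p hellinger' score_cont' info'
    by (intro conjI ballI square_integrable_matrix_vector_mult exI[of _ \<mu>]
        exI[of _ "\<lambda>\<nu>. p (f \<nu>)"]) auto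
qed

text \<open>The nuisance path \<open>\<psi>\<close> is composed with \<open>f\<close>, so that it
  still passes through \<open>G0\<close> at \<open>\<nu>0\<close> and the laws are those of the old
  submodel at \<open>f \<nu>\<close>.\<close>

lemma regular_submodel_reparametrize:
  fixes f :: "real^'d \<Rightarrow> real^'k" and Df :: "real^'d \<Rightarrow> real^'d^'k"
  assumes "regular_submodel M \<Theta> \<G> P (f \<nu>0) G0 \<psi> s"
    and "\<nu>0 \<in> N" "open N" "f ` N \<subseteq> \<Theta>" "inj_on f N"
    and "\<And>\<nu>. \<nu> \<in> N \<Longrightarrow> (f has_derivative (\<lambda>h. Df \<nu> *v h)) (at \<nu>)"
    and "continuous_on N Df" "\<And>\<nu>. \<nu> \<in> N \<Longrightarrow> inj ((*v) (Df \<nu>))"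
  shows "regular_submodel M N \<G> (\<lambda>\<nu>. P (f \<nu>)) \<nu>0 G0 (\<lambda>\<nu>. \<psi> (f \<nu>))
    (\<lambda>\<nu> x. transpose (Df \<nu>) *v s (f \<nu>) x)"
proof -
  have "regular_parametric_model_score M \<Theta> (\<lambda>\<theta>. P \<theta> (\<psi> \<theta>)) s"
    and "\<psi> ` \<Theta> \<subseteq> \<G>" "\<psi> (f \<nu>0) = G0"
    using assms(1) by (simp_all add: regular_submodel_def)
  with assms(2,4) regular_parametric_model_score_reparametrize[OF this(1) assms(3-8)]
  show ?thesis
    unfolding regular_submodel_def by blast
qed

section \<open>Convergence in probability\<close>

text \<open>An event is eventual for this filter when its probability under the law of the first \<open>n\<close>
  observations tends to 1; convergence in probability is then convergence along this filter.\<close>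

definition prob_filter :: "'a measure \<Rightarrow> (nat \<times> (nat \<Rightarrow> 'a)) filter" where
  "prob_filter P = Abs_filter (\<lambda>Q. \<forall>\<eta>>0. \<forall>\<^sub>F n in sequentially.
     \<exists>A\<in>sets (sample P n). measure (sample P n) A < \<eta> \<and> (\<forall>x\<in>space (sample P n) - A. Q (n, x)))"

text \<open>Closure under conjunction is the union bound with \<open>\<eta>\<close> split into
  halves. The measurable exceptional set \<open>A\<close> covers the failures of \<open>Q\<close>,
  whose own measurability stays open.\<close>

lemma eventually_prob_filter:
  "eventually Q (prob_filter P) \<longleftrightarrow> (\<forall>\<eta>>0. \<forall>\<^sub>F n in sequentially.
     \<exists>A\<in>sets (sample P n). measure (sample P n) A < \<eta> \<and> (\<forall>x\<in>space (sample P n) - A. Q (n, x)))"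
  unfolding prob_filter_def
proof (rule eventually_Abs_filter, rule is_filter.intro)
  show "\<forall>\<eta>>0. \<forall>\<^sub>F n in sequentially. \<exists>A\<in>sets (sample P n).
      measure (sample P n) A < \<eta> \<and> (\<forall>x\<in>space (sample P n) - A. True)"
    by (auto intro!: always_eventually exI[of _ "{}"] bexI[of _ "{}"])
next
  fix Q R :: "nat \<times> (nat \<Rightarrow> 'a) \<Rightarrow> bool"
  assume Q: "\<forall>\<eta>>0. \<forall>\<^sub>F n in sequentially. \<exists>A\<in>sets (sample P n).
      measure (sample P n) A < \<eta> \<and> (\<forall>x\<in>space (sample P n) - A. Q (n, x))"
    and R: "\<forall>\<eta>>0. \<forall>\<^sub>F n in sequentially. \<exists>A\<in>sets (sample P n).
      measure (sample P n) A < \<eta> \<and> (\<forall>x\<in>space (sample P n) - A. R (n, x))"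
  show "\<forall>\<eta>>0. \<forall>\<^sub>F n in sequentially. \<exists>A\<in>sets (sample P n).
      measure (sample P n) A < \<eta> \<and> (\<forall>x\<in>space (sample P n) - A. Q (n, x) \<and> R (n, x))"
  proof (intro allI impI)
    fix \<eta> :: real
    assume "\<eta> > 0"
    then have "\<eta> / 2 > 0" by simp
    from Q[rule_format, OF this] R[rule_format, OF this]
    show "\<forall>\<^sub>F n in sequentially. \<exists>A\<in>sets (sample P n).
      measure (sample P n) A < \<eta> \<and> (\<forall>x\<in>space (sample P n) - A. Q (n, x) \<and> R (n, x))"
    proof eventually_elim
      fix n
      assume "\<exists>A\<in>sets (sample P n). measure (sample P n) A < \<eta> / 2 \<and>
          (\<forall>x\<in>space (sample P n) - A. Q (n, x))"
        and "\<exists>A\<in>sets (sample P n). measure (sample P n) A < \<eta> / 2 \<and>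
          (\<forall>x\<in>space (sample P n) - A. R (n, x))"
      then obtain A B where AB: "A \<in> sets (sample P n)" "B \<in> sets (sample P n)"
        "measure (sample P n) A < \<eta> / 2" "measure (sample P n) B < \<eta> / 2"
        "\<forall>x\<in>space (sample P n) - A. Q (n, x)" "\<forall>x\<in>space (sample P n) - B. R (n, x)"
        by blast
      moreover have "measure (sample P n) (A \<union> B) \<le> measure (sample P n) A + measure (sample P n) B"
        using AB(1,2) by (rule measure_Un_le)
      ultimately show "\<exists>A\<in>sets (sample P n). measure (sample P n) A < \<eta> \<and>
          (\<forall>x\<in>space (sample P n) - A. Q (n, x) \<and> R (n, x))"
        by (intro bexI[of _ "A \<union> B"]) auto
    qed
  qed
next
  fix Q R :: "nat \<times> (nat \<Rightarrow> 'a) \<Rightarrow> bool"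
  assume imp: "\<forall>z. Q z \<longrightarrow> R z"
    and Q: "\<forall>\<eta>>0. \<forall>\<^sub>F n in sequentially. \<exists>A\<in>sets (sample P n).
      measure (sample P n) A < \<eta> \<and> (\<forall>x\<in>space (sample P n) - A. Q (n, x))"
  show "\<forall>\<eta>>0. \<forall>\<^sub>F n in sequentially. \<exists>A\<in>sets (sample P n).
      measure (sample P n) A < \<eta> \<and> (\<forall>x\<in>space (sample P n) - A. R (n, x))"
    using Q by (elim all_forward imp_forward eventually_mono) (use imp in blast)+
qed

section \<open>Passing between probability statements and filter limits\<close>

lemma prob_space_sample: "prob_space P \<Longrightarrow> prob_space (sample P n)"
  unfolding sample_def by (intro prob_space_PiM)

text \<open>Makes deterministic limits in the sample size available along the filter; the
  exceptional set is empty.\<close>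

lemma filterlim_fst_prob_filter: "filterlim fst sequentially (prob_filter P)"
  unfolding filterlim_iff eventually_prob_filter
proof (intro allI impI)
  fix Q and \<eta> :: real
  assume Q: "eventually Q sequentially" and "\<eta> > 0"
  show "\<forall>\<^sub>F n in sequentially. \<exists>A\<in>sets (sample P n). measure (sample P n) A < \<eta> \<and>
      (\<forall>x\<in>space (sample P n) - A. Q (fst (n, x)))"
    using Q by (rule eventually_mono) (use \<open>\<eta> > 0\<close> in \<open>simp add: bexI[of _ "{}"]\<close>)
qed

lemma eventually_prob_filter_space:
  assumes "\<And>n x. x \<in> space (sample P n) \<Longrightarrow> Q (n, x)"
  shows "eventually Q (prob_filter P)"
  unfolding eventually_prob_filter
proof (intro allI impI always_eventually)
  fix \<eta> :: real and n
  assume "\<eta> > 0"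
  then show "\<exists>A\<in>sets (sample P n). measure (sample P n) A < \<eta> \<and>
      (\<forall>x\<in>space (sample P n) - A. Q (n, x))"
    using assms by (intro bexI[of _ "{}"]) simp_all
qed

lemma tendsto_in_prob_imp_tendsto:
  fixes Y :: "nat \<Rightarrow> (nat \<Rightarrow> 'a) \<Rightarrow> 'b::{real_normed_vector, second_countable_topology}"
  assumes Y: "tendsto_in_prob P Y c" and meas: "\<And>n. Y n \<in> borel_measurable (sample P n)"
  shows "((\<lambda>(n, x). Y n x) \<longlongrightarrow> c) (prob_filter P)"
proof (rule tendstoI)
  fix e :: real
  assume "e > 0"
  \<comment> \<open>Halving \<open>e\<close> turns the weak inequality that holds off this set into
    the strict one demanded by \<open>tendstoI\<close>.\<close>
  let ?A = "\<lambda>n. {x \<in> space (sample P n). e / 2 < norm (Y n x - c)}"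
  show "\<forall>\<^sub>F z in prob_filter P. dist (case z of (n, x) \<Rightarrow> Y n x) c < e"
    unfolding eventually_prob_filter
  proof (intro allI impI)
    fix \<eta> :: real
    assume "\<eta> > 0"
    have "(\<lambda>n. measure (sample P n) (?A n)) \<longlonglongrightarrow> 0"
      using Y half_gt_zero[OF \<open>e > 0\<close>] unfolding tendsto_in_prob_def by blast
    then have "\<forall>\<^sub>F n in sequentially. measure (sample P n) (?A n) < \<eta>"
      using \<open>\<eta> > 0\<close> by (rule order_tendstoD)
    then show "\<forall>\<^sub>F n in sequentially. \<exists>A\<in>sets (sample P n). measure (sample P n) A < \<eta> \<and>
        (\<forall>x\<in>space (sample P n) - A. dist (case (n, x) of (n, x) \<Rightarrow> Y n x) c < e)"
    proof eventually_elim
      fix n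
      note [measurable] = meas[of n]
      assume "measure (sample P n) (?A n) < \<eta>"
      moreover have "?A n \<in> sets (sample P n)"
        by measurable
      ultimately show "\<exists>A\<in>sets (sample P n). measure (sample P n) A < \<eta> \<and>
          (\<forall>x\<in>space (sample P n) - A. dist (case (n, x) of (n, x) \<Rightarrow> Y n x) c < e)"
        using \<open>e > 0\<close> by (intro bexI[of _ "?A n"]) (auto simp: dist_norm)
    qed
  qed
qed

lemma tendsto_in_probI:
  assumes "prob_space P" and Y: "((\<lambda>(n, x). Y n x) \<longlongrightarrow> c) (prob_filter P)"
  shows "tendsto_in_prob P Y c"
  unfolding tendsto_in_prob_def
proof (intro allI impI, rule tendstoI)
  fix \<epsilon> \<eta> :: real
  assume "\<epsilon> > 0" "\<eta> > 0"
  have "\<forall>\<^sub>F z in prob_filter P. dist (case z of (n, x) \<Rightarrow> Y n x) c < \<epsilon>"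
    using Y \<open>\<epsilon> > 0\<close> by (rule tendstoD)
  then have "\<forall>\<^sub>F n in sequentially. \<exists>A\<in>sets (sample P n). measure (sample P n) A < \<eta> \<and>
      (\<forall>x\<in>space (sample P n) - A. dist (Y n x) c < \<epsilon>)"
    using \<open>\<eta> > 0\<close> by (simp add: eventually_prob_filter)
  then show "\<forall>\<^sub>F n in sequentially. dist (measure (sample P n)
      {x \<in> space (sample P n). \<epsilon> < norm (Y n x - c)}) 0 < \<eta>"
  proof eventually_elim
    fix n
    assume "\<exists>A\<in>sets (sample P n). measure (sample P n) A < \<eta> \<and>
      (\<forall>x\<in>space (sample P n) - A. dist (Y n x) c < \<epsilon>)"
    then obtain A where A: "A \<in> sets (sample P n)" "measure (sample P n) A < \<eta>"
      "\<forall>x\<in>space (sample P n) - A. dist (Y n x) c < \<epsilon>" by blast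
    interpret prob_space "sample P n"
      using assms(1) by (rule prob_space_sample)
    \<comment> \<open>Monotonicity asks for measurability of the larger set \<open>A\<close> only; a
      nonmeasurable left-hand set would have measure 0 by default.\<close>
    have "measure (sample P n) {x \<in> space (sample P n). \<epsilon> < norm (Y n x - c)} \<le> measure (sample P n) A"
      using A(1,3) by (intro finite_measure_mono) (force simp: dist_norm)+
    with A(2) show "dist (measure (sample P n)
        {x \<in> space (sample P n). \<epsilon> < norm (Y n x - c)}) 0 < \<eta>"
      by simp
  qed
qed

text \<open>The rule that a null sequence times a tight sequence is null in probability, in a
  bilinear form that serves scalar and matrix products alike.\<close>

lemma tendsto_bilinear_bounded_in_prob:
  assumes h: "bounded_bilinear h"
    and Z: "(Z \<longlongrightarrow> 0) (prob_filter P)"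
    and Y: "bounded_in_prob P Y" and meas: "\<And>n. Y n \<in> borel_measurable (sample P n)"
  shows "((\<lambda>(n, x). h (Z (n, x)) (Y n x)) \<longlongrightarrow> 0) (prob_filter P)"
proof (rule tendstoI)
  fix e :: real
  assume "e > 0"
  obtain C where C: "C > 0" "\<And>a b. norm (h a b) \<le> norm a * norm b * C"
    using bounded_bilinear.pos_bounded[OF h] by blast
  show "\<forall>\<^sub>F z in prob_filter P. dist (case z of (n, x) \<Rightarrow> h (Z (n, x)) (Y n x)) 0 < e"
    unfolding eventually_prob_filter
  proof (intro allI impI)
    fix \<eta> :: real
    assume "\<eta> > 0"
    then have "\<eta> / 2 > 0" by simp
    then obtain K where K: "\<forall>\<^sub>F n in sequentially.
        measure (sample P n) {x \<in> space (sample P n). K < norm (Y n x)} < \<eta> / 2"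
      using Y unfolding bounded_in_prob_def by blast
    \<comment> \<open>Chosen so that \<open>\<delta> * (\<bar>K\<bar> + 1) * C = e\<close>. The
      bound \<open>K\<close> may be 0 or negative, hence \<open>\<bar>K\<bar> + 1\<close>.\<close>
    define \<delta> where "\<delta> = e / (C * (\<bar>K\<bar> + 1))"
    have "\<delta> > 0" using \<open>e > 0\<close> C(1) by (simp add: \<delta>_def)
    have "\<forall>\<^sub>F z in prob_filter P. norm (Z z) < \<delta>"
      using tendstoD[OF Z \<open>\<delta> > 0\<close>] by simp
    from this[unfolded eventually_prob_filter, rule_format, OF \<open>\<eta> / 2 > 0\<close>]
    have "\<forall>\<^sub>F n in sequentially. \<exists>A\<in>sets (sample P n). measure (sample P n) A < \<eta> / 2 \<and>
        (\<forall>x\<in>space (sample P n) - A. norm (Z (n, x)) < \<delta>)"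
      .
    with K show "\<forall>\<^sub>F n in sequentially. \<exists>A\<in>sets (sample P n). measure (sample P n) A < \<eta> \<and>
        (\<forall>x\<in>space (sample P n) - A. dist (case (n, x) of (n, x) \<Rightarrow> h (Z (n, x)) (Y n x)) 0 < e)"
    proof eventually_elim
      fix n
      note [measurable] = meas[of n]
      let ?B = "{x \<in> space (sample P n). K < norm (Y n x)}"
      assume B: "measure (sample P n) ?B < \<eta> / 2"
        and "\<exists>A\<in>sets (sample P n). measure (sample P n) A < \<eta> / 2 \<and>
          (\<forall>x\<in>space (sample P n) - A. norm (Z (n, x)) < \<delta>)"
      then obtain A where A: "A \<in> sets (sample P n)" "measure (sample P n) A < \<eta> / 2"
        "\<forall>x\<in>space (sample P n) - A. norm (Z (n, x)) < \<delta>" by blast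
      have B_sets: "?B \<in> sets (sample P n)"
        by measurable
      have "norm (h (Z (n, x)) (Y n x)) < e" if x: "x \<in> space (sample P n) - (A \<union> ?B)" for x
      proof -
        have Yx: "norm (Y n x) \<le> \<bar>K\<bar> + 1" and Zx: "norm (Z (n, x)) < \<delta>"
          using A(3) x by (auto simp: not_less)
        have "norm (h (Z (n, x)) (Y n x)) \<le> norm (Z (n, x)) * norm (Y n x) * C"
          by (rule C(2))
        also have "\<dots> \<le> norm (Z (n, x)) * (\<bar>K\<bar> + 1) * C"
          using Yx C(1) by (intro mult_right_mono mult_left_mono) auto
        also have "\<dots> < \<delta> * (\<bar>K\<bar> + 1) * C"
          using Zx C(1) by (intro mult_strict_right_mono) auto
        also have "\<dots> = e"
          using C(1) by (simp add: \<delta>_def field_simps add_nonneg_eq_0_iff)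
        finally show ?thesis .
      qed
      moreover have "measure (sample P n) (A \<union> ?B) < \<eta>"
        using measure_Un_le[OF A(1) B_sets] A(2) B by linarith
      ultimately show "\<exists>A\<in>sets (sample P n). measure (sample P n) A < \<eta> \<and>
          (\<forall>x\<in>space (sample P n) - A. dist (case (n, x) of (n, x) \<Rightarrow> h (Z (n, x)) (Y n x)) 0 < e)"
        using A(1) B_sets by (intro bexI[of _ "A \<union> ?B"]) auto
    qed
  qed
qed

text \<open>A single limit law has small tails, and a continuous ramp carries this over to the
  converging laws.\<close>

lemma weakly_converges_imp_bounded_in_prob:
  fixes Y :: "nat \<Rightarrow> (nat \<Rightarrow> 'a) \<Rightarrow> 'b::real_normed_vector"
  assumes "prob_space P" "prob_space L" and L: "sets L = sets borel"
    and meas: "\<And>n. Y n \<in> borel_measurable (sample P n)"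
    and weak: "weakly_converges (\<lambda>n. distr (sample P n) borel (Y n)) L"
  shows "bounded_in_prob P Y"
  unfolding bounded_in_prob_def
proof (intro allI impI)
  fix \<epsilon> :: real
  assume "\<epsilon> > 0"
  interpret L: prob_space L by fact
  have [measurable_cong]: "sets L = sets borel" by (fact L)
  have sp: "space L = UNIV" using sets_eq_imp_space_eq[OF L] by simp
  have tail_sets: "{y. real m < norm y} \<in> sets L" for m
    unfolding L by (intro borel_open open_Collect_less continuous_intros)
  have "(\<lambda>m. measure L {y. real m < norm y}) \<longlonglongrightarrow> measure L (\<Inter>m. {y. real m < norm y})"
  proof (rule L.finite_Lim_measure_decseq)
    show "range (\<lambda>m. {y. real m < norm y}) \<subseteq> sets L"
      using tail_sets by blast
    show "decseq (\<lambda>m. {y :: 'b. real m < norm y})"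
      unfolding decseq_def by (intro allI impI Collect_mono) linarith
  qed
  moreover have "(\<Inter>m. {y :: 'b. real m < norm y}) = {}"
    using reals_Archimedean2 by (fastforce dest: less_asym)
  ultimately have "(\<lambda>m. measure L {y. real m < norm y}) \<longlonglongrightarrow> 0"
    by simp
  then have "\<forall>\<^sub>F m in sequentially. measure L {y. real m < norm y} < \<epsilon>"
    using \<open>\<epsilon> > 0\<close> by (rule order_tendstoD)
  then obtain m where m: "measure L {y. real m < norm y} < \<epsilon>"
    using eventually_happens'[OF sequentially_bot] by blast
  \<comment> \<open>The ramp lies below the indicator of norms above \<open>m\<close> and above that
    of norms above \<open>m + 1\<close>. The first comparison is used under \<open>L\<close>, the
    second under the sample laws.\<close>
  define g :: "'b \<Rightarrow> real" where "g y = min 1 (max 0 (norm y - real m))" for y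
  have g01: "0 \<le> g y" "g y \<le> 1" for y by (auto simp: g_def)
  have g_cont: "continuous_on UNIV g" unfolding g_def by (intro continuous_intros)
  have g_meas[measurable]: "g \<in> borel_measurable borel"
    using g_cont by (rule borel_measurable_continuous_onI)
  have g_bdd: "bounded (range g)"
    using g01 by (auto simp: bounded_iff intro!: exI[of _ 1])
  have "(\<integral>y. g y \<partial>L) \<le> (\<integral>y. indicator {y. real m < norm y} y \<partial>L)"
  proof (rule integral_mono)
    show "integrable L g"
      using g01 by (intro L.integrable_const_bound[of _ 1]) auto
    show "integrable L (indicator {y. real m < norm y} :: 'b \<Rightarrow> real)"
      using tail_sets by (intro integrable_real_indicator) (simp_all add: L.emeasure_eq_measure)
  qed (auto simp: g_def indicator_def)
  also have "\<dots> = measure L {y. real m < norm y}"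
    using sp by simp
  also have "\<dots> < \<epsilon>" by (fact m)
  finally have "(\<integral>y. g y \<partial>L) < \<epsilon>" .
  moreover have "(\<lambda>n. \<integral>y. g y \<partial>distr (sample P n) borel (Y n)) \<longlonglongrightarrow> (\<integral>y. g y \<partial>L)"
    using weak g_cont g_bdd by (simp add: weakly_converges_def)
  ultimately have "\<forall>\<^sub>F n in sequentially. (\<integral>y. g y \<partial>distr (sample P n) borel (Y n)) < \<epsilon>"
    by (intro order_tendstoD)
  then have "\<forall>\<^sub>F n in sequentially.
      measure (sample P n) {x \<in> space (sample P n). real m + 1 < norm (Y n x)} < \<epsilon>"
  proof eventually_elim
    fix n
    assume *: "(\<integral>y. g y \<partial>distr (sample P n) borel (Y n)) < \<epsilon>"
    interpret S: prob_space "sample P n"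
      using assms(1) by (rule prob_space_sample)
    note [measurable] = meas[of n]
    let ?B = "{x \<in> space (sample P n). real m + 1 < norm (Y n x)}"
    have "measure (sample P n) ?B = (\<integral>x. indicator ?B x \<partial>sample P n)"
      by (simp add: Int_absorb1)
    also have "\<dots> \<le> (\<integral>x. g (Y n x) \<partial>sample P n)"
    proof (rule integral_mono)
      show "integrable (sample P n) (\<lambda>x. g (Y n x))"
        using g01 by (intro S.integrable_const_bound[of _ 1]) auto
      show "integrable (sample P n) (indicator ?B :: _ \<Rightarrow> real)"
        by (intro integrable_real_indicator) (measurable, simp add: S.emeasure_eq_measure)
    qed (auto simp: g_def indicator_def)
    also have "\<dots> = (\<integral>y. g y \<partial>distr (sample P n) borel (Y n))"
      by (simp add: integral_distr)
    finally show "measure (sample P n) ?B < \<epsilon>"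
      using * by linarith
  qed
  then show "\<exists>K. \<forall>\<^sub>F n in sequentially.
      measure (sample P n) {x \<in> space (sample P n). K < norm (Y n x)} < \<epsilon>" ..
qed

text \<open>The constant sequence \<open>\<theta>0\<close> is a local sequence with all deviations
  0, and along it every submodel through the point has the law
  \<open>P \<theta>0 G0\<close>.\<close>

lemma regular_estimator_imp_bounded_in_prob:
  assumes "regular_estimator M \<Theta> \<G> P \<theta>0 G0 T" "regular_submodel M \<Theta> \<G> P \<theta>0 G0 \<psi> s"
    and "\<And>n. T n \<in> borel_measurable (sample (P \<theta>0 G0) n)"
  shows "bounded_in_prob (P \<theta>0 G0) (\<lambda>n x. sqrt (real n) *\<^sub>R (T n x - \<theta>0))"
proof -
  have \<psi>: "\<theta>0 \<in> \<Theta>" "\<psi> \<theta>0 = G0" and "prob_space (P \<theta>0 (\<psi> \<theta>0))"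
    using assms(2) by (auto simp: regular_submodel_def regular_parametric_model_score_def)
  then have prob: "prob_space (P \<theta>0 G0)"
    by simp
  have "locally_regular \<Theta> (\<lambda>\<theta>. P \<theta> (\<psi> \<theta>)) \<theta>0 T"
    using assms(1,2) by (auto simp: regular_estimator_def)
  then obtain L where L: "prob_space L" "sets L = sets borel"
    and weak: "\<And>t. (\<forall>n. t n \<in> \<Theta>) \<and> bounded (range (\<lambda>n. sqrt (real n) *\<^sub>R (t n - \<theta>0))) \<Longrightarrow>
      weakly_converges (\<lambda>n. distr (sample (P (t n) (\<psi> (t n))) n) borel
        (\<lambda>x. sqrt (real n) *\<^sub>R (T n x - t n))) L"
    unfolding locally_regular_def by blast
  have "bounded (range (\<lambda>n. sqrt (real n) *\<^sub>R (\<theta>0 - \<theta>0)))"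
    by (simp add: image_constant_conv)
  with weak[of "\<lambda>_. \<theta>0"] \<psi>
  have "weakly_converges (\<lambda>n. distr (sample (P \<theta>0 G0) n) borel
      (\<lambda>x. sqrt (real n) *\<^sub>R (T n x - \<theta>0))) L"
    by simp
  with prob L show ?thesis
    using assms(3) by (intro weakly_converges_imp_bounded_in_prob) auto
qed

lemma sets_sample_cong: "sets P = sets M \<Longrightarrow> sets (sample P n) = sets (sample M n)"
  unfolding sample_def by (rule sets_PiM_cong) auto

lemma measurable_sample_cong:
  "sets P = sets M \<Longrightarrow> measurable (sample P n) N = measurable (sample M n) N"
  by (intro measurable_cong_sets sets_sample_cong) auto

section \<open>The one-step estimator\<close>

text \<open>Meant for \<open>wls_step\<close>, whose continuity is known on a set of admissible
  arguments only: the estimators are read as maps into the Borel space restricted to that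
  set.\<close>

lemma borel_measurable_continuous_on_values:
  assumes "continuous_on S h" "g \<in> borel_measurable M" "\<And>x. x \<in> space M \<Longrightarrow> g x \<in> S"
  shows "(\<lambda>x. h (g x)) \<in> borel_measurable M"
proof (rule measurable_compose[where f = g and g = h])
  show "g \<in> measurable M (restrict_space borel S)"
    using assms(2,3) by (intro measurable_restrict_space2) auto
  show "h \<in> borel_measurable (restrict_space borel S)"
    using assms(1) by (rule borel_measurable_continuous_on_restrict)
qed

definition wls_step ::
  "(real^'d \<Rightarrow> real^'k) \<Rightarrow> (real^'d \<Rightarrow> real^'d^'k) \<Rightarrow> real^'d \<Rightarrow> real^'k^'k \<Rightarrow> real^'k \<Rightarrow> real^'d" where
  "wls_step f Df \<nu> A \<theta> = \<nu> + wls (Df \<nu>) A *v (\<theta> - f \<nu>)"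

lemma continuous_on_wls_step:
  fixes f :: "real^'d \<Rightarrow> real^'k"
  assumes "continuous_on N f" "continuous_on N Df" "\<And>\<nu>. \<nu> \<in> N \<Longrightarrow> inj ((*v) (Df \<nu>))"
  shows "continuous_on (N \<times> {A. sym_pos_def A} \<times> UNIV) (\<lambda>(\<nu>, A, \<theta>). wls_step f Df \<nu> A \<theta>)"
proof -
  let ?S = "N \<times> {A. sym_pos_def A} \<times> (UNIV :: (real^'k) set)"
  have "continuous_on ?S (\<lambda>z. case (Df (fst z), fst (snd z)) of (D, A) \<Rightarrow> wls D A)"
    using assms(2,3)
    by (intro continuous_on_compose2[OF continuous_on_wls] continuous_intros
        continuous_on_compose2[OF assms(2)]) auto
  then have "continuous_on ?S (\<lambda>z. wls (Df (fst z)) (fst (snd z)))"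
    by simp
  then show ?thesis
    unfolding wls_step_def case_prod_beta
    by (intro continuous_intros continuous_on_compose2[OF assms(1)]
        bounded_bilinear.continuous_on[OF bounded_bilinear_matrix_vector_mult]) auto
qed

text \<open>With \<open>C\<close> the random coefficient matrix and \<open>?K\<close> its limit, the
  scaled error splits into four null terms: \<open>C - ?K\<close> times the tight \<open>W\<close>;
  \<open>?K\<close> times the linearization error \<open>E\<close> of \<open>\<theta>hat\<close>;
  \<open>mat 1 - C ** Df \<nu>0\<close> times the tight \<open>B\<close>; and the curvature of
  \<open>f\<close>, which is \<open>C\<close> applied to \<open>\<rho>\<close> and scaled by
  \<open>norm (B n x)\<close>.\<close>

lemma asymptotically_linear_wls_step:
  fixes f :: "real^'d \<Rightarrow> real^'k" and Df :: "real^'d \<Rightarrow> real^'d^'k"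
  assumes "prob_space P" and h: "h \<in> borel_measurable P"
    and \<nu>0: "\<nu>0 \<in> N" and deriv: "(f has_derivative (\<lambda>v. Df \<nu>0 *v v)) (at \<nu>0)"
    and Df_cont: "continuous_on N Df"
    and Df_inj: "\<And>\<nu>. \<nu> \<in> N \<Longrightarrow> inj ((*v) (Df \<nu>))"
    and \<theta>_meas: "\<And>n. \<theta>hat n \<in> borel_measurable (sample P n)"
    and \<theta>_lin: "asymptotically_linear P \<theta>hat (f \<nu>0) h"
    and \<theta>_bdd: "bounded_in_prob P (\<lambda>n x. sqrt (real n) *\<^sub>R (\<theta>hat n x - f \<nu>0))"
    and I_meas: "\<And>n. Ihat n \<in> borel_measurable (sample P n)"
    and I_pos: "\<And>n x. x \<in> space (sample P n) \<Longrightarrow> sym_pos_def (Ihat n x)"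
    and I_lim: "tendsto_in_prob P Ihat A" and A: "sym_pos_def A"
    and \<nu>_meas: "\<And>n. \<nu>bar n \<in> borel_measurable (sample P n)"
    and \<nu>_N: "\<And>n x. x \<in> space (sample P n) \<Longrightarrow> \<nu>bar n x \<in> N"
    and \<nu>_bdd: "bounded_in_prob P (\<lambda>n x. sqrt (real n) *\<^sub>R (\<nu>bar n x - \<nu>0))"
  shows "asymptotically_linear P (\<lambda>n x. wls_step f Df (\<nu>bar n x) (Ihat n x) (\<theta>hat n x)) \<nu>0
    (\<lambda>x. wls (Df \<nu>0) A *v h x)"
proof -
  let ?F = "prob_filter P"
  define B where "B n x = sqrt (real n) *\<^sub>R (\<nu>bar n x - \<nu>0)" for n x
  define W where "W n x = sqrt (real n) *\<^sub>R (\<theta>hat n x - f \<nu>0)" for n x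
  define E where "E n x = sqrt (real n) *\<^sub>R (\<theta>hat n x - f \<nu>0 - (1 / real n) *\<^sub>R (\<Sum>i<n. h (x i)))" for n x
  define C where "C z = (case z of (n, x) \<Rightarrow> wls (Df (\<nu>bar n x)) (Ihat n x))" for z
  \<comment> \<open>The difference quotient remainder of \<open>f\<close>. Since
    \<open>1 / 0 = 0\<close>, it vanishes at \<open>\<nu>0\<close> and is continuous there, so it
    may be evaluated at \<open>\<nu>bar\<close> even when that equals \<open>\<nu>0\<close>.\<close>
  define \<rho> where "\<rho> \<nu> = (1 / norm (\<nu> - \<nu>0)) *\<^sub>R (f \<nu> - (f \<nu>0 + Df \<nu>0 *v (\<nu> - \<nu>0)))" for \<nu>
  let ?K = "wls (Df \<nu>0) A"
  have h_meas: "(\<lambda>x. h (x i)) \<in> borel_measurable (sample P n)" if "i < n" for i n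
    unfolding sample_def using that
    by (intro measurable_compose[where f = "\<lambda>x. x i" and g = h, OF _ h]
        measurable_component_singleton) simp
  have B_meas: "B n \<in> borel_measurable (sample P n)" for n
    unfolding B_def[abs_def] using \<nu>_meas[of n] by measurable
  have W_meas: "W n \<in> borel_measurable (sample P n)" for n
    unfolding W_def[abs_def] using \<theta>_meas[of n] by measurable
  have "E n \<in> borel_measurable (sample P n)" for n
    unfolding E_def[abs_def] using \<theta>_meas[of n] h_meas
    by (intro borel_measurable_scaleR borel_measurable_diff borel_measurable_sum borel_measurable_const) auto
  with \<theta>_lin have E_lim: "((\<lambda>(n, x). E n x) \<longlongrightarrow> 0) ?F"
    unfolding asymptotically_linear_def E_def[abs_def] by (rule tendsto_in_prob_imp_tendsto)
  have I_tendsto: "((\<lambda>(n, x). Ihat n x) \<longlongrightarrow> A) ?F"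
    using I_lim I_meas by (rule tendsto_in_prob_imp_tendsto)
  \<comment> \<open>Consistency of \<open>\<nu>bar\<close>: the tight \<open>B\<close> is divided by
    the root of \<open>n\<close>. At \<open>n = 0\<close> this division fails to recover
    \<open>\<nu>bar n x - \<nu>0\<close>, hence the restriction to positive \<open>n\<close>
    below.\<close>
  have "((\<lambda>z. 1 / sqrt (real (fst z))) \<longlongrightarrow> 0) ?F"
  proof (rule filterlim_compose[OF _ filterlim_fst_prob_filter])
    show "(\<lambda>n. 1 / sqrt (real n)) \<longlonglongrightarrow> 0"
      by (intro tendsto_divide_0[OF tendsto_const] filterlim_at_top_imp_at_infinity
          filterlim_compose[OF sqrt_at_top filterlim_real_sequentially])
  qed
  then have "((\<lambda>(n, x). (1 / sqrt (real (fst (n, x)))) *\<^sub>R B n x) \<longlongrightarrow> 0) ?F"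
    using \<nu>_bdd B_meas unfolding B_def[symmetric]
    by (rule tendsto_bilinear_bounded_in_prob[OF bounded_bilinear_scaleR])
  moreover have pos: "\<forall>\<^sub>F z in ?F. 0 < fst z"
    using eventually_gt_at_top filterlim_fst_prob_filter by (rule eventually_compose_filterlim)
  then have "\<forall>\<^sub>F z in ?F. (case z of (n, x) \<Rightarrow> (1 / sqrt (real (fst (n, x)))) *\<^sub>R B n x) =
      (case z of (n, x) \<Rightarrow> \<nu>bar n x) - \<nu>0"
    by eventually_elim (auto simp: B_def)
  ultimately have "((\<lambda>z. (case z of (n, x) \<Rightarrow> \<nu>bar n x) - \<nu>0) \<longlongrightarrow> 0) ?F"
    by (rule Lim_transform_eventually)
  then have \<nu>_tendsto: "((\<lambda>(n, x). \<nu>bar n x) \<longlongrightarrow> \<nu>0) ?F"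
    by (rule Lim_null[THEN iffD2])
  have \<nu>_ev: "\<forall>\<^sub>F z in ?F. (case z of (n, x) \<Rightarrow> \<nu>bar n x) \<in> N"
    by (rule eventually_prob_filter_space) (simp add: \<nu>_N)
  have "((\<lambda>z. Df (case z of (n, x) \<Rightarrow> \<nu>bar n x)) \<longlongrightarrow> Df \<nu>0) ?F"
    by (rule continuous_on_tendsto_compose[OF Df_cont \<nu>_tendsto \<nu>0 \<nu>_ev])
  from tendsto_Pair[OF this I_tendsto]
  have "((\<lambda>z. (\<lambda>(D, A). wls D A) (Df (case z of (n, x) \<Rightarrow> \<nu>bar n x), case z of (n, x) \<Rightarrow> Ihat n x))
      \<longlongrightarrow> (\<lambda>(D, A). wls D A) (Df \<nu>0, A)) ?F"
  proof (rule continuous_on_tendsto_compose[OF continuous_on_wls])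
    show "(Df \<nu>0, A) \<in> {(D, A). sym_pos_def A \<and> inj ((*v) D)}"
      using A Df_inj[OF \<nu>0] by simp
    show "\<forall>\<^sub>F z in ?F. (Df (case z of (n, x) \<Rightarrow> \<nu>bar n x), case z of (n, x) \<Rightarrow> Ihat n x)
        \<in> {(D, A). sym_pos_def A \<and> inj ((*v) D)}"
      by (rule eventually_prob_filter_space) (simp add: \<nu>_N Df_inj I_pos)
  qed
  then have C_lim: "(C \<longlongrightarrow> ?K) ?F"
    by (simp add: C_def[abs_def] case_prod_beta)
  have \<rho>_lim: "((\<lambda>z. \<rho> (case z of (n, x) \<Rightarrow> \<nu>bar n x)) \<longlongrightarrow> 0) ?F"
  proof -
    have "(\<rho> \<longlongrightarrow> 0) (at \<nu>0)"
      using deriv by (simp add: has_derivative_within \<rho>_def[abs_def])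
    then have "isCont \<rho> \<nu>0"
      by (simp add: isCont_def \<rho>_def)
    from isCont_tendsto_compose[OF this \<nu>_tendsto] show ?thesis
      by (simp add: \<rho>_def)
  qed
  note bilinear = bounded_bilinear_matrix_vector_mult
  have "((\<lambda>z. C z - ?K) \<longlongrightarrow> 0) ?F"
    using C_lim by (rule LIM_zero)
  then have t1: "((\<lambda>(n, x). (C (n, x) - ?K) *v W n x) \<longlongrightarrow> 0) ?F"
    using \<theta>_bdd W_meas unfolding W_def[symmetric]
    by (rule tendsto_bilinear_bounded_in_prob[OF bilinear])
  have t2: "((\<lambda>z. ?K *v (case z of (n, x) \<Rightarrow> E n x)) \<longlongrightarrow> 0) ?F"
    using bounded_bilinear.tendsto[OF bilinear tendsto_const E_lim] by simp
  \<comment> \<open>\<open>C\<close> is a left inverse of the Jacobian at \<open>\<nu>bar\<close>,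
    not at \<open>\<nu>0\<close>, so the difference is handled in the limit, where \<open>?K\<close>
    is a left inverse at \<open>\<nu>0\<close>.\<close>
  have "((\<lambda>z. mat 1 - C z ** Df \<nu>0) \<longlongrightarrow> mat 1 - ?K ** Df \<nu>0) ?F"
    by (intro tendsto_diff tendsto_const C_lim
        bounded_bilinear.tendsto[OF bounded_bilinear_matrix_matrix_mult])
  then have "((\<lambda>z. mat 1 - C z ** Df \<nu>0) \<longlongrightarrow> 0) ?F"
    using wls_mult_left[OF A Df_inj[OF \<nu>0]] by simp
  then have t3: "((\<lambda>(n, x). (mat 1 - C (n, x) ** Df \<nu>0) *v B n x) \<longlongrightarrow> 0) ?F"
    using \<nu>_bdd B_meas unfolding B_def[symmetric]
    by (rule tendsto_bilinear_bounded_in_prob[OF bilinear])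
  have "((\<lambda>z. C z *v \<rho> (case z of (n, x) \<Rightarrow> \<nu>bar n x)) \<longlongrightarrow> ?K *v 0) ?F"
    by (intro bounded_bilinear.tendsto[OF bilinear] C_lim \<rho>_lim)
  then have "((\<lambda>z. norm (C z *v \<rho> (case z of (n, x) \<Rightarrow> \<nu>bar n x))) \<longlongrightarrow> 0) ?F"
    by (simp add: tendsto_norm_zero)
  then have "((\<lambda>(n, x). norm (C (n, x) *v \<rho> (case (n, x) of (n, x) \<Rightarrow> \<nu>bar n x)) *\<^sub>R B n x) \<longlongrightarrow> 0) ?F"
    using \<nu>_bdd B_meas unfolding B_def[symmetric]
    by (rule tendsto_bilinear_bounded_in_prob[OF bounded_bilinear_scaleR])
  \<comment> \<open>Exchanging the factor that is normed with the one that is scaled leaves the norm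
    of the product unchanged.\<close>
  then have t4: "((\<lambda>z. case z of (n, x) \<Rightarrow> norm (B n x) *\<^sub>R (C (n, x) *v \<rho> (\<nu>bar n x))) \<longlongrightarrow> 0) ?F"
    by (subst tendsto_norm_zero_iff[symmetric], subst (asm) tendsto_norm_zero_iff[symmetric])
       (simp add: case_prod_beta mult.commute)
  let ?err = "\<lambda>n x. sqrt (real n) *\<^sub>R (wls_step f Df (\<nu>bar n x) (Ihat n x) (\<theta>hat n x) - \<nu>0
      - (1 / real n) *\<^sub>R (\<Sum>i<n. ?K *v h (x i)))"
  have decomp: "?err n x = (C (n, x) - ?K) *v W n x + ?K *v E n x
      + (mat 1 - C (n, x) ** Df \<nu>0) *v B n x - norm (B n x) *\<^sub>R (C (n, x) *v \<rho> (\<nu>bar n x))" for n x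
  proof -
    let ?c = "sqrt (real n)" and ?\<nu> = "\<nu>bar n x" and ?C = "C (n, x)"
    \<comment> \<open>Both sides are 0 when \<open>?\<nu> = \<nu>0\<close>; otherwise the norm
      cancels.\<close>
    have "norm (?\<nu> - \<nu>0) *\<^sub>R \<rho> ?\<nu> = f ?\<nu> - (f \<nu>0 + Df \<nu>0 *v (?\<nu> - \<nu>0))"
      by (cases "?\<nu> = \<nu>0") (simp_all add: \<rho>_def)
    then have "norm (B n x) *\<^sub>R \<rho> ?\<nu> = ?c *\<^sub>R (f ?\<nu> - (f \<nu>0 + Df \<nu>0 *v (?\<nu> - \<nu>0)))"
      by (metis B_def abs_of_nonneg norm_scaleR of_nat_0_le_iff real_sqrt_ge_zero scaleR_scaleR)
    then have \<rho>: "norm (B n x) *\<^sub>R (?C *v \<rho> ?\<nu>) =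
        ?C *v (?c *\<^sub>R (f ?\<nu> - (f \<nu>0 + Df \<nu>0 *v (?\<nu> - \<nu>0))))"
      by (metis matrix_vector_mult_scaleR)
    have sum: "?K *v (\<Sum>i<n. h (x i)) = (\<Sum>i<n. ?K *v h (x i))"
      by (rule linear_sum[OF matrix_vector_mul_linear])
    have assoc: "(mat 1 - ?C ** Df \<nu>0) *v B n x = B n x - ?C *v (Df \<nu>0 *v B n x)"
      by (simp add: matrix_vector_mult_diff_rdistrib matrix_vector_mul_assoc)
    show ?thesis
      unfolding \<rho> assoc
      unfolding W_def E_def B_def wls_step_def
      by (simp add: C_def sum algebra_simps)
  qed
  have "((\<lambda>z. (case z of (n, x) \<Rightarrow> (C (n, x) - ?K) *v W n x) + ?K *v (case z of (n, x) \<Rightarrow> E n x)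
      + (case z of (n, x) \<Rightarrow> (mat 1 - C (n, x) ** Df \<nu>0) *v B n x)
      - (case z of (n, x) \<Rightarrow> norm (B n x) *\<^sub>R (C (n, x) *v \<rho> (\<nu>bar n x)))) \<longlongrightarrow> 0 + 0 + 0 - 0) ?F"
    by (intro tendsto_diff tendsto_add t1 t2 t3 t4)
  then have "((\<lambda>(n, x). ?err n x) \<longlongrightarrow> 0) ?F"
    unfolding decomp case_prod_beta' by simp
  then show ?thesis
    unfolding asymptotically_linear_def using \<open>prob_space P\<close> by (intro tendsto_in_probI)
qed

text \<open>Efficiency is anchored in the restricted model itself: \<open>lQ\<close> is shown to be
  one of its efficient scores, and \<open>inflQ\<close> to be the influence function belonging to
  that score.\<close>

theorem theorem4p1:
  fixes M :: "'a measure"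
    and \<Theta> :: "(real^'k) set" and \<G> :: "'g set"
    and P :: "real^'k \<Rightarrow> 'g \<Rightarrow> 'a measure"
    and N :: "(real^'d) set"
    and f :: "real^'d \<Rightarrow> real^'k" and Df :: "real^'d \<Rightarrow> real^'d^'k"
    and finv :: "real^'k \<Rightarrow> real^'d" and Dfinv :: "real^'k \<Rightarrow> real^'k^'d"
    and \<nu>0 :: "real^'d" and \<theta>0 :: "real^'k" and G0 :: 'g and P0 :: "'a measure"
    and l :: "real^'k \<Rightarrow> 'g \<Rightarrow> 'a \<Rightarrow> real^'k"
    and I :: "real^'k \<Rightarrow> 'g \<Rightarrow> real^'k^'k"
    and \<theta>hat :: "nat \<Rightarrow> (nat \<Rightarrow> 'a) \<Rightarrow> real^'k"
    and Ihat :: "nat \<Rightarrow> (nat \<Rightarrow> 'a) \<Rightarrow> real^'k^'k"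
    and \<nu>bar :: "nat \<Rightarrow> (nat \<Rightarrow> 'a) \<Rightarrow> real^'d"
    and \<nu>hat :: "nat \<Rightarrow> (nat \<Rightarrow> 'a) \<Rightarrow> real^'d"
    and lQ :: "'a \<Rightarrow> real^'d" and inflQ :: "'a \<Rightarrow> real^'d"
  assumes "open \<Theta>" and "regular_semiparametric_model M \<Theta> \<G> P"
    and "open N" and "CARD('d) < CARD('k)" and "f ` N \<subseteq> \<Theta>"
    and "\<And>\<nu>. \<nu> \<in> N \<Longrightarrow> (f has_derivative (\<lambda>h. Df \<nu> *v h)) (at \<nu>)"
    and "continuous_on N Df"
    and "\<And>\<nu>. \<nu> \<in> N \<Longrightarrow> rank (Df \<nu>) = CARD('d)"
    and "\<And>\<nu>. \<nu> \<in> N \<Longrightarrow> finv (f \<nu>) = \<nu>"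
    and "\<And>\<theta>. \<theta> \<in> f ` N \<Longrightarrow> (finv has_derivative (\<lambda>h. Dfinv \<theta> *v h)) (at \<theta> within f ` N)"
    and "bounded (Dfinv ` f ` N)"
    and "\<nu>0 \<in> N" and "\<theta>0 = f \<nu>0" and "G0 \<in> \<G>" and "P0 = P \<theta>0 G0"
    and "\<And>\<theta> G. \<theta> \<in> \<Theta> \<Longrightarrow> G \<in> \<G> \<Longrightarrow> efficient_score M \<Theta> \<G> P \<theta> G (l \<theta> G)"
    and "\<And>\<theta> G. \<theta> \<in> \<Theta> \<Longrightarrow> G \<in> \<G> \<Longrightarrow> I \<theta> G = information (P \<theta> G) (l \<theta> G)"
    and "regular_estimator M \<Theta> \<G> P \<theta>0 G0 \<theta>hat"
    and "asymptotically_linear P0 \<theta>hat \<theta>0 (\<lambda>x. matrix_inv (I \<theta>0 G0) *v l \<theta>0 G0 x)"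
    and "estimator M Ihat"
    and "\<And>n x. x \<in> space (sample M n) \<Longrightarrow> sym_pos_def (Ihat n x)"
    and "\<And>\<theta> G. \<theta> \<in> \<Theta> \<Longrightarrow> G \<in> \<G> \<Longrightarrow> tendsto_in_prob (P \<theta> G) Ihat (I \<theta> G)"
    and "estimator M \<nu>bar"
    and "\<And>n x. x \<in> space (sample M n) \<Longrightarrow> \<nu>bar n x \<in> N"
    and "\<And>\<nu> G. \<nu> \<in> N \<Longrightarrow> G \<in> \<G> \<Longrightarrow>
           bounded_in_prob (P (f \<nu>) G) (\<lambda>n x. sqrt (real n) *\<^sub>R (\<nu>bar n x - \<nu>))"
    and "\<And>n x. \<nu>hat n x = \<nu>bar n x +
           (matrix_inv (transpose (Df (\<nu>bar n x)) ** Ihat n x ** Df (\<nu>bar n x))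
              ** transpose (Df (\<nu>bar n x)) ** Ihat n x) *v (\<theta>hat n x - f (\<nu>bar n x))"
    and "\<And>x. lQ x = transpose (Df \<nu>0) *v l \<theta>0 G0 x"
    and "\<And>x. inflQ x =
           (matrix_inv (transpose (Df \<nu>0) ** I \<theta>0 G0 ** Df \<nu>0) ** transpose (Df \<nu>0)) *v l \<theta>0 G0 x"
  shows "estimator M \<nu>hat \<and>
         efficient_score M N \<G> (\<lambda>\<nu> G. P (f \<nu>) G) \<nu>0 G0 lQ \<and>
         influence P0 lQ = inflQ \<and>
         asymptotically_linear P0 \<nu>hat \<nu>0 inflQ"
proof -

  \<comment> \<open>Consequences of the hypotheses at the true point\<close>
  let ?l = "l \<theta>0 G0" and ?A = "I \<theta>0 G0" and ?D = "Df \<nu>0"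
  have \<theta>0_in: "\<theta>0 \<in> \<Theta>"
    using assms(5,12,13) by auto
  have Df_inj: "inj ((*v) (Df \<nu>))" if "\<nu> \<in> N" for \<nu>
    using assms(8)[OF that] by (simp add: full_rank_injective)
  have f_inj: "inj_on f N"
    using assms(9) by (rule inj_on_inverseI)
  have f_cont: "continuous_on N f"
    using assms(6) by (meson continuous_at_imp_continuous_on has_derivative_continuous)
  obtain \<psi> where \<psi>: "least_favorable_sequence M \<Theta> \<G> P \<theta>0 G0 \<psi> ?l"
    using assms(16)[OF \<theta>0_in assms(14)] by (auto simp: efficient_score_def)
  then obtain s where sub: "\<And>j. regular_submodel M \<Theta> \<G> P \<theta>0 G0 (\<psi> j) (s j)"
    and s_lim: "(\<lambda>j. L2norm P0 (\<lambda>x. s j \<theta>0 x - ?l x)) \<longlonglongrightarrow> 0"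
    and l_sq: "square_integrable P0 ?l" and inv: "invertible (information P0 ?l)"
    unfolding least_favorable_sequence_def assms(15) by blast
  have A_eq: "?A = information P0 ?l"
    using assms(17)[OF \<theta>0_in assms(14)] assms(15) by simp
  have A: "sym_pos_def ?A"
    unfolding A_eq by (rule sym_pos_def_information[OF l_sq inv])
  have P0: "prob_space P0" "sets P0 = sets M" and s_sq: "square_integrable P0 (s j \<theta>0)" for j
    using sub[of j] assms(15)
    by (auto simp: regular_submodel_def regular_parametric_model_score_def)
  have space_eq: "space (sample P0 n) = space (sample M n)" for n
    using sets_sample_cong[OF P0(2)] by (rule sets_eq_imp_space_eq)
  have \<theta>_meas: "\<theta>hat n \<in> borel_measurable (sample M n)"
    and I_meas: "Ihat n \<in> borel_measurable (sample M n)"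
    and \<nu>_meas: "\<nu>bar n \<in> borel_measurable (sample M n)" for n
    using assms(18,20,23) by (auto simp: regular_estimator_def estimator_def)
  then have P0_meas: "\<theta>hat n \<in> borel_measurable (sample P0 n)"
    "Ihat n \<in> borel_measurable (sample P0 n)" "\<nu>bar n \<in> borel_measurable (sample P0 n)" for n
    by (simp_all only: measurable_sample_cong[OF P0(2)])
  have \<nu>hat: "\<nu>hat = (\<lambda>n x. wls_step f Df (\<nu>bar n x) (Ihat n x) (\<theta>hat n x))"
    by (intro ext) (simp only: assms(26) wls_step_def wls_def)

  \<comment> \<open>Measurability of the one-step estimator\<close>
  have est: "estimator M \<nu>hat"
    unfolding estimator_def
  proof
    fix n
    have "(\<lambda>x. (\<lambda>(\<nu>, A, \<theta>). wls_step f Df \<nu> A \<theta>) (\<nu>bar n x, Ihat n x, \<theta>hat n x))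
        \<in> borel_measurable (sample M n)"
      using \<theta>_meas I_meas \<nu>_meas assms(21,24)
      by (intro borel_measurable_continuous_on_values[OF
            continuous_on_wls_step[OF f_cont assms(7) Df_inj]] borel_measurable_Pair) auto
    then show "\<nu>hat n \<in> borel_measurable (sample M n)"
      by (simp add: \<nu>hat)
  qed

  \<comment> \<open>Asymptotic linearity at the true point\<close>
  have "wls ?D ?A ** matrix_inv ?A = matrix_inv (transpose ?D ** ?A ** ?D) ** transpose ?D"
    unfolding wls_def using matrix_inv_right[OF sym_pos_def_imp_invertible[OF A]]
    by (simp flip: matrix_mul_assoc)
  \<comment> \<open>The weight matrix cancels against the inverse information, so
    \<open>inflQ\<close> is the limiting coefficient matrix applied to the influence function of
    \<open>\<theta>hat\<close>.\<close>
  then have inflQ: "inflQ = (\<lambda>x. wls ?D ?A *v (matrix_inv ?A *v ?l x))"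
    by (simp add: fun_eq_iff assms(28) matrix_vector_mul_assoc)
  have lin: "asymptotically_linear P0 \<nu>hat \<nu>0 inflQ"
    unfolding inflQ \<nu>hat
  proof (rule asymptotically_linear_wls_step)
    show "(\<lambda>x. matrix_inv ?A *v ?l x) \<in> borel_measurable P0"
      using square_integrable_matrix_vector_mult[OF l_sq]
      unfolding square_integrable_def by (rule conjunct1)
    show "bounded_in_prob P0 (\<lambda>n x. sqrt (real n) *\<^sub>R (\<theta>hat n x - f \<nu>0))"
      \<comment> \<open>Any member of the least favorable sequence serves here; index 0 is
        taken.\<close>
      using regular_estimator_imp_bounded_in_prob[OF assms(18) sub[of 0], folded assms(15),
          OF P0_meas(1)]
      by (simp only: assms(13))
    show "asymptotically_linear P0 \<theta>hat (f \<nu>0) (\<lambda>x. matrix_inv ?A *v ?l x)"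
      using assms(19) by (simp only: assms(13))
    show "tendsto_in_prob P0 Ihat ?A"
      using assms(22)[OF \<theta>0_in assms(14)] by (simp add: assms(15))
    show "bounded_in_prob P0 (\<lambda>n x. sqrt (real n) *\<^sub>R (\<nu>bar n x - \<nu>0))"
      using assms(25)[OF assms(12,14)] by (simp add: assms(13,15))
  qed (use P0 assms(6,7,12,21,24) Df_inj A P0_meas space_eq in auto)

  \<comment> \<open>Efficient score of the restricted model\<close>
  have lQ: "lQ = (\<lambda>x. transpose ?D *v ?l x)"
    by (rule ext) (rule assms(27))
  have info: "information P0 lQ = transpose ?D ** ?A ** ?D"
    unfolding lQ information_matrix_vector_mult[OF l_sq] A_eq by (simp only: transpose_transpose)
  have infl: "influence P0 lQ = inflQ"
    by (rule ext) (simp only: influence_def info assms(27,28) matrix_vector_mul_assoc)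

  have "least_favorable_sequence M N \<G> (\<lambda>\<nu> G. P (f \<nu>) G) \<nu>0 G0 (\<lambda>j \<nu>. \<psi> j (f \<nu>)) lQ"
    unfolding least_favorable_sequence_def assms(13)[symmetric] assms(15)[symmetric]
  proof (intro conjI exI allI)
    show "square_integrable P0 lQ"
      unfolding lQ using l_sq by (rule square_integrable_matrix_vector_mult)
    show "regular_submodel M N \<G> (\<lambda>\<nu> G. P (f \<nu>) G) \<nu>0 G0 (\<lambda>\<nu>. \<psi> j (f \<nu>))
        (\<lambda>\<nu> x. transpose (Df \<nu>) *v s j (f \<nu>) x)" for j
      using sub[of j] unfolding assms(13)
      by (rule regular_submodel_reparametrize[OF _ assms(12,3,5) f_inj assms(6,7) Df_inj])
    \<comment> \<open>At \<open>\<nu>0\<close> the new score differs from \<open>lQ\<close> by the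
      fixed matrix \<open>transpose ?D\<close> applied to the old difference, so convergence carries
      over up to a constant.\<close>
    have "(\<lambda>j. 2 * norm (transpose ?D) * L2norm P0 (\<lambda>x. s j \<theta>0 x - ?l x)) \<longlonglongrightarrow> 0"
      using tendsto_mult_right_zero[OF s_lim] .
    then have "(\<lambda>j. L2norm P0 (\<lambda>x. transpose ?D *v (s j \<theta>0 x - ?l x))) \<longlonglongrightarrow> 0"
      by (rule Lim_null_comparison[rotated])
         (simp add: L2norm_nonneg L2norm_matrix_vector_mult_le square_integrable_diff s_sq l_sq
           del: transpose_matrix_vector)
    then show "(\<lambda>j. L2norm P0 (\<lambda>x. transpose ?D *v s j (f \<nu>0) x - lQ x)) \<longlonglongrightarrow> 0"
      by (simp only: lQ matrix_vector_mult_diff_distrib assms(13))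
    show "invertible (information P0 lQ)"
      unfolding info
      by (rule sym_pos_def_imp_invertible[OF sym_pos_def_congruence[OF A Df_inj[OF assms(12)]]])
    show "estimator M \<nu>hat" by (fact est)
    show "asymptotically_linear P0 \<nu>hat \<nu>0 (influence P0 lQ)"
      unfolding infl by (fact lin)
  qed
  then have "efficient_score M N \<G> (\<lambda>\<nu> G. P (f \<nu>) G) \<nu>0 G0 lQ"
    unfolding efficient_score_def by blast
  with est infl lin show ?thesis
    by blast
qed

end
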